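(* Let $R$ be a Dedekind domain with fraction field $K$, let $\mathbf{X}\in R^{n\times n}$ be a symmetric matrix, and suppose that $\mathbf{Y}\in R^{n\times n}$ and a nonzero matrix $\mathbf{Q}\in K^{n\times n}$ satisfy $\mathbf{X}\mathbf{Q}=\mathbf{Q}\mathbf{Y}$ and $\mathbf{Q}^{\mathsf T}\mathbf{Q}\in R^{n\times n}$. Let $\mathcal{L}$ be the level of $\mathbf{Q}$. Assume that $\mathcal{P}^e\mid\mathcal{L}$ for some nonzero prime ideal $\mathcal{P}\subseteq R$ and some integer $e\geq 1$, and let $\Gamma\in (R/\mathcal{P})[x]$ be the approximate square root of $\phi_{\mathbf{X}}$ modulo $\mathcal{P}$. Then there exists $w\in R^n$ with $w\not\equiv 0\bmod\mathcal{P}$ for which the Krylov space $\mathcal{K}_{\mathbf{X}}(w)$ is $\Gamma$-contractive up to level $\mathcal{P}^e$ and isotropic up to level $\mathcal{P}^{2e}$.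
   Context: Rings are commutative and unital. The level of $\mathbf{Q}$ is the ideal $\mathcal{L}=\{r\in R: r\mathbf{Q}\in R^{n\times n}\}$; for ideals, $\mathcal{B}\mid\mathcal{A}$ means $\mathcal{B}\mathcal{C}=\mathcal{A}$ for some ideal $\mathcal{C}\subseteq R$. For vectors, $w\equiv 0\bmod\mathcal{I}$ means that all entries lie in the ideal $\mathcal{I}$. Approximate square root: let $\phi_{\mathbf{X}}(x)=\det(x\mathbf{I}-\mathbf{X})$ and factor $\phi_{\mathbf{X}}\equiv\prod_{i=1}^m\gamma_i^{d_i}\bmod\mathcal{P}$ with $\gamma_1,\dots,\gamma_m\in\mathbb{F}_{\mathcal{P}}[x]$ distinct monic irreducible, $d_i\ge1$, $\mathbb{F}_{\mathcal{P}}=R/\mathcal{P}$. Then $\Gamma=\prod_{i=1}^m\gamma_i^{\lfloor d_i/2\rfloor}$. An $R$-submodule $\mathcal{M}\subseteq R^n$ is $\Gamma$-contractive up to level $\mathcal{P}^e$ if for every integer $0\le k\leq e-1$ and every $q\in\mathcal{M}\cap(\mathcal{P}^k)^n$ one has $\Gamma(\mathbf{X})q\equiv 0\bmod\mathcal{P}^{k+1}$ (here $\Gamma$ may be replaced by any lift to $R[x]$; the condition does not depend on the lift, and $\mathcal{P}^0=R$). It is isotropic up to level $\mathcal{P}^{e}$ if $q_1^{\mathsf T}q_2\equiv 0\bmod\mathcal{P}^{e}$ for all $q_1,q_2\in\mathcal{M}$. The Krylov space of $w_1,\dots,w_m\in R^n$ is $\mathcal{K}_{\mathbf{X}}(w_1,\dots,w_m)=\{\sum_{j=1}^m\sum_{i=0}^{n-1}c_{i,j}\mathbf{X}^iw_j: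 c_{i,j}\in R\}$. *)

theory Defs
  imports
    "Jordan_Normal_Form.Char_Poly"
    "Jordan_Normal_Form.VS_Connect"
    "HOL-Algebra.Ideal_Product"
    "HOL-Algebra.Ring_Divisibility"
    "HOL-Computational_Algebra.Polynomial_Factorial"
begin

text \<open>
  The ring \<open>R\<close> is a type of class \<^class>\<open>idom\<close>; its ideals are treated through
  the record \<open>class_ring\<close> of the type, so that ideals, primes, products, powers and
  divisibility of ideals are those of HOL-Algebra.
\<close>

definition ideal_power :: "'a::comm_ring_1 set \<Rightarrow> nat \<Rightarrow> 'a set" where
  "ideal_power I k = I [^]\<^bsub>ideals_set class_ring\<^esub> k"

definition ideal_dvd :: "'a::comm_ring_1 set \<Rightarrow> 'a set \<Rightarrow> bool" where
  "ideal_dvd B A \<longleftrightarrow> B divides\<^bsub>ideals_set class_ring\<^esub> A"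

definition integrally_closed :: "'a::idom itself \<Rightarrow> bool" where
  "integrally_closed _ \<longleftrightarrow>
    (\<forall>x :: 'a fract. (\<exists>p :: 'a poly. monic p \<and> poly (map_poly to_fract p) x = 0)
       \<longrightarrow> x \<in> range to_fract)"

text \<open>Fields count as Dedekind domains here; they have no nonzero prime ideal.\<close>

definition dedekind_domain :: "'a::idom itself \<Rightarrow> bool" where
  "dedekind_domain T \<longleftrightarrow>
     noetherian_domain (class_ring :: 'a ring) \<and>
     integrally_closed T \<and>
     (\<forall>P :: 'a set. primeideal P class_ring \<and> P \<noteq> {0} \<longrightarrow> maximalideal P class_ring)"

text \<open>
  A quotient by an ideal that is a variable cannot be formed as a type.  The residue field
  \<open>R/P\<close> is therefore an arbitrary field type together with a surjective ring
  homomorphism onto it with kernel \<open>P\<close>, which determines it up to unique isomorphism over \<open>R\<close>.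
\<close>

definition residue_map :: "'a::comm_ring_1 set \<Rightarrow> ('a \<Rightarrow> 'k::field) \<Rightarrow> bool" where
  "residue_map P \<pi> \<longleftrightarrow> comm_ring_hom \<pi> \<and> surj \<pi> \<and> {r. \<pi> r = 0} = P"

definition is_approx_sqrt :: "'k::field poly \<Rightarrow> 'k poly \<Rightarrow> bool" where
  "is_approx_sqrt \<phi> \<Gamma> \<longleftrightarrow>
     (\<exists>m (\<gamma> :: nat \<Rightarrow> 'k poly) (d :: nat \<Rightarrow> nat).
        inj_on \<gamma> {..<m} \<and>
        (\<forall>i<m. monic (\<gamma> i) \<and> Factorial_Ring.irreducible (\<gamma> i) \<and> d i \<ge> 1) \<and>
        \<phi> = (\<Prod>i<m. \<gamma> i ^ d i) \<and>
        \<Gamma> = (\<Prod>i<m. \<gamma> i ^ (d i div 2)))"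

text \<open>The \<open>n \<times> n\<close> matrices over the fraction field with all entries in \<open>R\<close>.\<close>

definition integral_mats :: "nat \<Rightarrow> 'a::idom fract mat set" where
  "integral_mats n = map_mat to_fract ` carrier_mat n n"

definition level :: "'a::idom fract mat \<Rightarrow> 'a set" where
  "level Q = {r. to_fract r \<cdot>\<^sub>m Q \<in> integral_mats (dim_row Q)}"

definition vec_cong0 :: "'a::comm_ring_1 vec \<Rightarrow> 'a set \<Rightarrow> bool" where
  "vec_cong0 v I \<longleftrightarrow> set\<^sub>v v \<subseteq> I"

definition poly_mat :: "'a::comm_ring_1 poly \<Rightarrow> 'a mat \<Rightarrow> 'a mat" where
  "poly_mat f X = mat (dim_row X) (dim_row X)
     (\<lambda>(i, j). \<Sum>k\<le>degree f. poly.coeff f k * (X ^\<^sub>m k) $$ (i, j))"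

text \<open>
  The quantification over all lifts \<open>G\<close> of \<open>\<Gamma>\<close> is harmless: since \<open>X\<close> is integral, the
  condition does not depend on the lift, and lifts exist because \<open>\<pi>\<close> is surjective.
  For \<open>e \<ge> 1\<close> the range \<open>0 \<le> k \<le> e - 1\<close> is \<open>k < e\<close>.
\<close>

definition contractive ::
  "('a::comm_ring_1 \<Rightarrow> 'k::field) \<Rightarrow> 'a set \<Rightarrow> nat \<Rightarrow> 'a mat \<Rightarrow> 'k poly \<Rightarrow> 'a vec set \<Rightarrow> bool"
where
  "contractive \<pi> P e X \<Gamma> M \<longleftrightarrow>
     (\<forall>G. map_poly \<pi> G = \<Gamma> \<longrightarrow>
       (\<forall>k<e. \<forall>q\<in>M. vec_cong0 q (ideal_power P k) \<longrightarrow>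
          vec_cong0 (poly_mat G X *\<^sub>v q) (ideal_power P (k + 1))))"

text \<open>The bound \<open>I\<close> will be a power of a prime ideal.\<close>

definition isotropic :: "'a::comm_ring_1 set \<Rightarrow> 'a vec set \<Rightarrow> bool" where
  "isotropic I M \<longleftrightarrow> (\<forall>q1\<in>M. \<forall>q2\<in>M. q1 \<bullet> q2 \<in> I)"

text \<open>The Krylov space of a list of vectors; \<open>n\<close> is the dimension of \<open>X\<close>.\<close>

definition krylov :: "'a::comm_ring_1 mat \<Rightarrow> 'a vec list \<Rightarrow> 'a vec set" where
  "krylov X ws =
     {vec (dim_row X) (\<lambda>r. \<Sum>j<length ws. \<Sum>i<dim_row X. c i j * ((X ^\<^sub>m i) *\<^sub>v (ws ! j)) $ r)
      | c :: nat \<Rightarrow> nat \<Rightarrow> 'a. True}"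

end

theory Submission
  imports Defs
begin

text \<open>
  Modulo \<open>P\<close>: let \<open>X\<close> be symmetric over a field, \<open>\<phi>\<close> its characteristic polynomial, and \<open>q\<close> a
  vector with \<open>q \<bullet> X\<^sup>i q = 0\<close> for all \<open>i\<close>.  The \<open>2 \<times> 2\<close> minors of \<open>adj (x - X)\<close> are divisible by \<open>\<phi>\<close>.  As
  \<open>q \<bullet> adj (x - X) q = 0\<close>, this says \<open>\<phi> dvd (l \<bullet> adj (x - X) q)\<^sup>2\<close> for every \<open>l\<close>, so that \<open>\<phi> / \<Gamma>\<close> divides
  \<open>adj (x - X) q\<close>.  Dividing \<open>(x - X) adj (x - X) q = \<phi> q\<close> by \<open>\<phi> / \<Gamma>\<close> and substituting \<open>X\<close> for \<open>x\<close>
  gives \<open>\<Gamma>(X) q = 0\<close>.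

  Over \<open>R\<close>: choose \<open>s\<close> in the level of \<open>Q\<close> such that some column \<open>w\<close> of \<open>s Q\<close> is nonzero modulo \<open>P\<close>.
  The Krylov space of \<open>w\<close> lies in \<open>s Q R\<^sup>n\<close>, and \<open>s \<in> P\<^sup>e\<close>, hence all scalar products are in \<open>P\<^bsup>2e\<^esup>\<close>.
  If \<open>q\<close> in the Krylov space vanishes modulo \<open>P\<^sup>k\<close> with \<open>k < e\<close>, then \<open>q\<close> divided by the \<open>k\<close>-th power
  of a uniformizer satisfies the isotropy hypothesis above modulo \<open>P\<close>.
\<close>

subsection \<open>Divisibility of the minors of the adjugate\<close>

text \<open>Bracketing \<open>transpose_mat (adj_mat A) * A * adj_mat A\<close> in the two possible
  ways gives \<open>det A\<close> times either matrix, and \<open>det A\<close> cancels in a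
  domain.\<close>

lemma transpose_adj_mat:
  fixes A :: "'a::idom mat"
  assumes A: "A \<in> carrier_mat n n" and sym: "transpose_mat A = A" and nz: "det A \<noteq> 0"
  shows "transpose_mat (adj_mat A) = adj_mat A"
proof -
  let ?B = "adj_mat A" and ?T = "transpose_mat (adj_mat A)"
  note B = adj_mat[OF A]
  have T: "?T \<in> carrier_mat n n" using B by simp
  have "?T * A = transpose_mat (A * ?B)"
    using transpose_mult[OF A B(1)] sym by simp
  also have "\<dots> = det A \<cdot>\<^sub>m 1\<^sub>m n" unfolding B by (intro eq_matI) auto
  finally have TA: "?T * A = det A \<cdot>\<^sub>m 1\<^sub>m n" .
  have "det A \<cdot>\<^sub>m ?T = ?T * (A * ?B)" unfolding B
    using T by (simp add: mult_smult_distrib[OF T one_carrier_mat])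
  also have "\<dots> = det A \<cdot>\<^sub>m ?B"
    using B(1) by (simp add: TA assoc_mult_mat[OF T A B(1), symmetric]
        mult_smult_assoc_mat[OF one_carrier_mat B(1)])
  finally have eq: "det A \<cdot>\<^sub>m ?T = det A \<cdot>\<^sub>m ?B" .
  show ?thesis
  proof (rule eq_matI)
    fix i j assume ij: "i < dim_row ?B" "j < dim_col ?B"
    from arg_cong[OF eq, of "\<lambda>M. M $$ (i, j)"] show "?T $$ (i, j) = ?B $$ (i, j)"
      using ij B(1) T nz by auto
  qed (use B(1) in auto)
qed

text \<open>Multiplying the bordered matrix by the second block matrix below clears its upper right
  block, as \<open>A * adj_mat A = det A\<close>.\<close>

lemma det_bordered_adj_mat:
  fixes A :: "'a::idom mat"
  assumes A: "A \<in> carrier_mat n n" and U: "U \<in> carrier_mat n m" and V: "V \<in> carrier_mat m n"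
  shows "det (four_block_mat A U V (0\<^sub>m m m)) * (- det A) ^ m
    = det A * det (V * (adj_mat A * U))"
proof -
  let ?B = "adj_mat A * U" and ?D = "(- det A) \<cdot>\<^sub>m 1\<^sub>m m"
  note Ad = adj_mat[OF A]
  have B: "?B \<in> carrier_mat n m" using Ad U by auto
  have D: "?D \<in> carrier_mat m m" by simp
  have AB: "A * ?B = det A \<cdot>\<^sub>m U"
  proof -
    have "A * ?B = det A \<cdot>\<^sub>m 1\<^sub>m n * U"
      unfolding Ad(2)[symmetric] by (rule assoc_mult_mat[OF A Ad(1) U, symmetric])
    then show ?thesis using U by (simp add: mult_smult_assoc_mat[OF one_carrier_mat U])
  qed
  have "four_block_mat A U V (0\<^sub>m m m) * four_block_mat (1\<^sub>m n) ?B (0\<^sub>m m n) ?D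
    = four_block_mat (A * 1\<^sub>m n + U * 0\<^sub>m m n) (A * ?B + U * ?D)
        (V * 1\<^sub>m n + 0\<^sub>m m m * 0\<^sub>m m n) (V * ?B + 0\<^sub>m m m * ?D)"
    by (rule mult_four_block_mat[OF A U V zero_carrier_mat one_carrier_mat B zero_carrier_mat D])
  also have "\<dots> = four_block_mat A (0\<^sub>m n m) V (V * ?B)"
  proof (rule cong_four_block_mat)
    have "U * ?D = (- det A) \<cdot>\<^sub>m U"
      using U by (simp add: mult_smult_distrib[OF U one_carrier_mat])
    then show "A * ?B + U * ?D = 0\<^sub>m n m" unfolding AB using U by (intro eq_matI) auto
  qed (use A U V mult_carrier_mat[OF V B] in auto)
  finally have "det (four_block_mat A U V (0\<^sub>m m m) * four_block_mat (1\<^sub>m n) ?B (0\<^sub>m m n) ?D)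
    = det A * det (V * ?B)"
    by (simp add: det_four_block_mat_upper_right_zero[OF A refl V mult_carrier_mat[OF V B]])
  moreover have "det (four_block_mat A U V (0\<^sub>m m m) * four_block_mat (1\<^sub>m n) ?B (0\<^sub>m m n) ?D)
    = det (four_block_mat A U V (0\<^sub>m m m)) * det (four_block_mat (1\<^sub>m n) ?B (0\<^sub>m m n) ?D)"
    by (rule det_mult[OF four_block_carrier_mat[OF A zero_carrier_mat] four_block_carrier_mat[OF one_carrier_mat D]])
  moreover have "det (four_block_mat (1\<^sub>m n) ?B (0\<^sub>m m n) ?D) = (- det A) ^ m"
    by (simp add: det_four_block_mat_lower_left_zero[OF one_carrier_mat B refl D])
  ultimately show ?thesis by simp
qed

lemma det_2_by_2:
  fixes A :: "'a::comm_ring_1 mat"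
  assumes A: "A \<in> carrier_mat 2 2"
  shows "det A = A $$ (0,0) * A $$ (1,1) - A $$ (0,1) * A $$ (1,0)"
proof -
  have perms: "{p. p permutes {0, Suc 0}} = {id, Transposition.transpose 0 1}"
    by (auto simp: permutes_doubleton_iff)
  have ne: "id \<noteq> Transposition.transpose 0 (1::nat)"
    by (metis id_apply transpose_apply_first zero_neq_one)
  show ?thesis
    using A ne by (simp add: det_def' numeral_2_eq_2 atLeast0_lessThan_Suc insert_commute perms sign_swap_id)
qed

text \<open>Border \<open>A\<close> with \<open>q\<close> and \<open>l\<close>, both as columns and
  as rows. The bordered determinant identity for two extra rows, after cancelling one factor
  \<open>det A\<close>, exhibits the determinant of the 2 x 2 matrix \<open>?W\<close> of values of
  the form \<open>adj_mat A\<close> at \<open>q\<close> and \<open>l\<close> as a multiple of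
  \<open>det A\<close>.\<close>

lemma det_dvd_adj_mat_minor:
  fixes A :: "'a::idom mat"
  assumes A: "A \<in> carrier_mat n n" and nz: "det A \<noteq> 0"
    and q: "q \<in> carrier_vec n" and l: "l \<in> carrier_vec n"
  shows "det A dvd (q \<bullet> (adj_mat A *\<^sub>v q)) * (l \<bullet> (adj_mat A *\<^sub>v l))
    - (q \<bullet> (adj_mat A *\<^sub>v l)) * (l \<bullet> (adj_mat A *\<^sub>v q))"
proof -
  let ?U = "mat_of_cols n [q, l]" and ?V = "mat_of_rows n [q, l]"
  let ?W = "?V * (adj_mat A * ?U)"
  have Ad: "adj_mat A \<in> carrier_mat n n" by (rule adj_mat[OF A])
  have U: "?U \<in> carrier_mat n 2" and V: "?V \<in> carrier_mat 2 n"
    by (simp_all add: numeral_2_eq_2 mat_of_cols_def mat_of_rows_def)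
  have W: "?W \<in> carrier_mat 2 2" using Ad U V by auto
  have ent: "?W $$ (i, j) = ([q, l] ! i) \<bullet> (adj_mat A *\<^sub>v ([q, l] ! j))"
    if "i < 2" "j < 2" for i j
  proof -
    have ql: "[q, l] ! i \<in> carrier_vec n" "[q, l] ! j \<in> carrier_vec n"
      using that q l by (auto simp: less_2_cases_iff)
    have "?W $$ (i, j) = row ?V i \<bullet> col (adj_mat A * ?U) j"
      using that Ad U V by (intro index_mult_mat) auto
    also have "row ?V i = [q, l] ! i" using that ql by (intro mat_of_rows_row) auto
    also have "col (adj_mat A * ?U) j = adj_mat A *\<^sub>v col ?U j"
      using that Ad U by (intro col_mult2) auto
    also have "col ?U j = [q, l] ! j" using that ql by (intro col_mat_of_cols) auto
    finally show ?thesis .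
  qed
  have "det ?W = ?W $$ (0,0) * ?W $$ (1,1) - ?W $$ (0,1) * ?W $$ (1,0)"
    by (rule det_2_by_2[OF W])
  also have "\<dots> = (q \<bullet> (adj_mat A *\<^sub>v q)) * (l \<bullet> (adj_mat A *\<^sub>v l))
    - (q \<bullet> (adj_mat A *\<^sub>v l)) * (l \<bullet> (adj_mat A *\<^sub>v q))"
    using ent[of 0 0] ent[of 1 1] ent[of 0 1] ent[of 1 0] by simp
  finally have dW: "det ?W = \<dots>" .
  have "det (four_block_mat A ?U ?V (0\<^sub>m 2 2)) * (- det A) ^ 2 = det A * det ?W"
    by (rule det_bordered_adj_mat[OF A U V])
  then have "det A * (det (four_block_mat A ?U ?V (0\<^sub>m 2 2)) * det A) = det A * det ?W"
    by (simp add: power2_eq_square algebra_simps)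
  then have "det (four_block_mat A ?U ?V (0\<^sub>m 2 2)) * det A = det ?W" using nz by simp
  then show ?thesis unfolding dW[symmetric] by (metis dvd_triv_right)
qed

subsection \<open>Vectors annihilated by the approximate square root\<close>

text \<open>The matrix \<open>char_poly_matrix X\<close> is \<open>x - X\<close>: multiplication by
  \<open>x\<close> shifts coefficients, while \<open>X\<close> acts on each of them. Equations
  between vectors of polynomials thus become recursions for their coefficient vectors.\<close>

lemma char_poly_matrix_mult_vec_coeff:
  fixes X :: "'a::comm_ring_1 mat"
  assumes X: "X \<in> carrier_mat n n" and v: "v \<in> carrier_vec n"
  shows "map_vec (\<lambda>p. poly.coeff p 0) (char_poly_matrix X *\<^sub>v v)
      = - (X *\<^sub>v map_vec (\<lambda>p. poly.coeff p 0) v)"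
    and "map_vec (\<lambda>p. poly.coeff p (Suc k)) (char_poly_matrix X *\<^sub>v v)
      = map_vec (\<lambda>p. poly.coeff p k) v - X *\<^sub>v map_vec (\<lambda>p. poly.coeff p (Suc k)) v"
proof -
  have ent: "(char_poly_matrix X *\<^sub>v v) $ i
      = pCons 0 (v $ i) - (\<Sum>j<n. Polynomial.smult (X $$ (i,j)) (v $ j))" if i: "i < n" for i
  proof -
    have "(char_poly_matrix X *\<^sub>v v) $ i
        = (\<Sum>j<n. ((if i = j then [:0,1:] else 0) + [: - X $$ (i,j) :]) * v $ j)"
      using X v i by (auto simp: char_poly_matrix_def scalar_prod_def lessThan_atLeast0 intro!: sum.cong)
    also have "\<dots> = (\<Sum>j<n. (if i = j then [:0,1:] * v $ j else 0) - Polynomial.smult (X $$ (i,j)) (v $ j))"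
      by (intro sum.cong) (auto simp: algebra_simps)
    also have "\<dots> = (\<Sum>j<n. (if i = j then [:0,1:] * v $ j else 0)) - (\<Sum>j<n. Polynomial.smult (X $$ (i,j)) (v $ j))"
      by (rule sum_subtractf)
    also have "(\<Sum>j<n. (if i = j then [:0,1:] * v $ j else 0)) = [:0,1:] * v $ i"
      using i by simp
    finally show ?thesis by simp
  qed
  have Xv: "(X *\<^sub>v map_vec (\<lambda>p. poly.coeff p k) v) $ i = (\<Sum>j<n. X $$ (i,j) * poly.coeff (v $ j) k)"
    if "i < n" for i k
    using X v that by (auto simp: scalar_prod_def lessThan_atLeast0 intro!: sum.cong)
  have dim: "dim_row (char_poly_matrix X) = n" using char_poly_matrix_closed[OF X] by simp
  show "map_vec (\<lambda>p. poly.coeff p 0) (char_poly_matrix X *\<^sub>v v)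
      = - (X *\<^sub>v map_vec (\<lambda>p. poly.coeff p 0) v)"
    using X v dim by (intro eq_vecI) (auto simp: ent Xv coeff_sum simp del: index_mult_mat_vec)
  show "map_vec (\<lambda>p. poly.coeff p (Suc k)) (char_poly_matrix X *\<^sub>v v)
      = map_vec (\<lambda>p. poly.coeff p k) v - X *\<^sub>v map_vec (\<lambda>p. poly.coeff p (Suc k)) v"
    using X v dim by (intro eq_vecI) (auto simp: ent Xv coeff_sum simp del: index_mult_mat_vec)
qed

lemma coeff_vec_eventually_zero:
  assumes "v \<in> carrier_vec n"
  obtains N where "\<And>k. k \<ge> N \<Longrightarrow> map_vec (\<lambda>p. poly.coeff p k) v = 0\<^sub>v n"
proof
  fix k assume k: "Suc (\<Sum>i<n. degree (v $ i)) \<le> k"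
  have "poly.coeff (v $ i) k = 0" if "i < n" for i
  proof (rule coeff_eq_0)
    have "degree (v $ i) \<le> (\<Sum>i<n. degree (v $ i))" using that by (intro member_le_sum) auto
    then show "degree (v $ i) < k" using k by simp
  qed
  then show "map_vec (\<lambda>p. poly.coeff p k) v = 0\<^sub>v n" using assms by (intro eq_vecI) auto
qed

lemma coeff_vec_smult_const:
  "map_vec (\<lambda>p. poly.coeff p k) (f \<cdot>\<^sub>v map_vec (\<lambda>a. [:a:]) q) = poly.coeff f k \<cdot>\<^sub>v (q :: 'a::comm_ring_1 vec)"
  by (intro eq_vecI) auto

lemma pow_Suc_mult_vec:
  assumes "X \<in> carrier_mat n n" "v \<in> carrier_vec n"
  shows "(X ^\<^sub>m Suc k) *\<^sub>v v = (X ^\<^sub>m k) *\<^sub>v (X *\<^sub>v v)"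
  using assms by (simp add: assoc_mult_mat_vec[of _ n n _ n])

lemma pow_Suc_mult_vec_left:
  assumes X: "X \<in> carrier_mat n n" and v: "v \<in> carrier_vec n"
  shows "(X ^\<^sub>m Suc k) *\<^sub>v v = X *\<^sub>v ((X ^\<^sub>m k) *\<^sub>v v)"
proof -
  have "X ^\<^sub>m Suc k = X * X ^\<^sub>m k"
  proof (induction k)
    case (Suc k)
    then show ?case using X by (simp add: assoc_mult_mat[of _ n n _ n _ n])
  qed (use X in simp)
  then show ?thesis using X v by (simp add: assoc_mult_mat_vec[of _ n n _ n])
qed

lemma mult_mat_vec_smult:
  fixes A :: "'a::comm_ring_1 mat"
  assumes "A \<in> carrier_mat m n" "v \<in> carrier_vec n"
  shows "A *\<^sub>v (c \<cdot>\<^sub>v v) = c \<cdot>\<^sub>v (A *\<^sub>v v)"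
  using assms by (intro eq_vecI) auto

text \<open>Substituting \<open>X\<close> for the variable in \<open>(x - X) v = f q\<close> makes the left side telescope.\<close>

lemma annihilates_if_char_poly_matrix_mult_eq:
  fixes X :: "'a::comm_ring_1 mat"
  assumes X: "X \<in> carrier_mat n n" and q: "q \<in> carrier_vec n" and v: "v \<in> carrier_vec n"
    and eq: "char_poly_matrix X *\<^sub>v v = f \<cdot>\<^sub>v map_vec (\<lambda>a. [:a:]) q"
    and N: "degree f \<le> N" and r: "r < n"
  shows "(\<Sum>k\<le>N. poly.coeff f k * ((X ^\<^sub>m k) *\<^sub>v q) $ r) = 0"
proof -
  define V where "V k = map_vec (\<lambda>p. poly.coeff p k) v" for k
  have V: "V k \<in> carrier_vec n" for k using v by (simp add: V_def)
  have XV: "X *\<^sub>v V k \<in> carrier_vec n" for k using X V by auto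
  have P: "X ^\<^sub>m k \<in> carrier_mat n n" for k using X by auto
  have eq0: "poly.coeff f 0 \<cdot>\<^sub>v q = - (X *\<^sub>v V 0)"
    using char_poly_matrix_mult_vec_coeff(1)[OF X v] unfolding eq coeff_vec_smult_const V_def .
  have eqS: "poly.coeff f (Suc k) \<cdot>\<^sub>v q = V k - X *\<^sub>v V (Suc k)" for k
    using char_poly_matrix_mult_vec_coeff(2)[OF X v] unfolding eq coeff_vec_smult_const V_def .
  have tel: "(\<Sum>k\<le>M. poly.coeff f k * ((X ^\<^sub>m k) *\<^sub>v q) $ r) = - ((X ^\<^sub>m Suc M) *\<^sub>v V M) $ r" for M
  proof (induction M)
    case 0
    have "poly.coeff f 0 * q $ r = (poly.coeff f 0 \<cdot>\<^sub>v q) $ r" using q r by simp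
    then show ?case using X q r XV[of 0] unfolding eq0 by simp
  next
    case (Suc M)
    have "poly.coeff f (Suc M) * ((X ^\<^sub>m Suc M) *\<^sub>v q) $ r
        = ((X ^\<^sub>m Suc M) *\<^sub>v (poly.coeff f (Suc M) \<cdot>\<^sub>v q)) $ r"
      unfolding mult_mat_vec_smult[OF P q]
      by (rule index_smult_vec(1)[symmetric]) (use carrier_matD[OF P] r in simp)
    also have "\<dots> = ((X ^\<^sub>m Suc M) *\<^sub>v V M) $ r - ((X ^\<^sub>m Suc (Suc M)) *\<^sub>v V (Suc M)) $ r"
      unfolding eqS pow_Suc_mult_vec[OF X V[of "Suc M"], of "Suc M"]
      using mult_minus_distrib_mat_vec[OF P[of "Suc M"] V[of M] XV[of "Suc M"]]
        X V XV r by (simp del: pow_mat.simps)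
    finally show ?case using Suc by (simp del: pow_mat.simps)
  qed
  obtain M where M: "\<And>k. k \<ge> M \<Longrightarrow> V k = 0\<^sub>v n"
    using coeff_vec_eventually_zero[OF v] unfolding V_def by blast
  \<comment> \<open>Above its degree \<open>f\<close> has no coefficients, so the sum may be
    lengthened until the boundary term of the telescoping sum contains only a vanishing coefficient
    of \<open>v\<close>.\<close>
  have "(\<Sum>k\<le>N. poly.coeff f k * ((X ^\<^sub>m k) *\<^sub>v q) $ r)
      = (\<Sum>k\<le>max M N. poly.coeff f k * ((X ^\<^sub>m k) *\<^sub>v q) $ r)"
    using N by (intro sum.mono_neutral_left) (auto simp: coeff_eq_0)
  also have "\<dots> = 0"
  proof -
    have "(X ^\<^sub>m Suc (max M N)) *\<^sub>v 0\<^sub>v n = 0\<^sub>v n" 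
      using X by (intro eq_vecI) (auto simp del: pow_mat.simps)
    then show ?thesis unfolding tel using M[of "max M N"] r by (simp del: pow_mat.simps)
  qed
  finally show ?thesis .
qed

lemma scalar_prod_mult_mat_vec_transpose:
  fixes X :: "'a::comm_ring_1 mat"
  assumes X: "X \<in> carrier_mat n n" and u: "u \<in> carrier_vec n" and v: "v \<in> carrier_vec n"
  shows "u \<bullet> (X *\<^sub>v v) = (transpose_mat X *\<^sub>v u) \<bullet> v"
  by (metis X transpose_vec_mult_scalar u v carrier_matD comm_scalar_prod mult_mat_vec_carrier transpose_carrier_mat)

text \<open>The coefficient vectors of \<open>v\<close> vanish from some index on, and going down
  each is \<open>X\<close> times the next one plus a multiple of \<open>q\<close>. They are
  therefore combinations of the vectors \<open>X^i q\<close>, all orthogonal to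
  \<open>q\<close>.\<close>

lemma cyclic_isotropic_solution:
  fixes X :: "'a::comm_ring_1 mat"
  assumes X: "X \<in> carrier_mat n n" and sym: "transpose_mat X = X"
    and q: "q \<in> carrier_vec n" and v: "v \<in> carrier_vec n"
    and iso: "\<And>i. ((X ^\<^sub>m i) *\<^sub>v q) \<bullet> q = 0"
    and eq: "char_poly_matrix X *\<^sub>v v = f \<cdot>\<^sub>v map_vec (\<lambda>a. [:a:]) q"
  shows "map_vec (\<lambda>a. [:a:]) q \<bullet> v = 0"
proof -
  define V where "V k = map_vec (\<lambda>p. poly.coeff p k) v" for k
  have V: "V k \<in> carrier_vec n" for k using v by (simp add: V_def)
  have XV: "X *\<^sub>v V k \<in> carrier_vec n" for k using X V by auto
  have P: "X ^\<^sub>m k \<in> carrier_mat n n" for k using X by auto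
  have Pq: "(X ^\<^sub>m k) *\<^sub>v q \<in> carrier_vec n" for k
    using mult_mat_vec_carrier[OF P q] .
  have eqS: "poly.coeff f (Suc k) \<cdot>\<^sub>v q = V k - X *\<^sub>v V (Suc k)" for k
    using char_poly_matrix_mult_vec_coeff(2)[OF X v] unfolding eq coeff_vec_smult_const V_def .
  have VS: "V k = X *\<^sub>v V (Suc k) + poly.coeff f (Suc k) \<cdot>\<^sub>v q" for k
    unfolding eqS using V[of k] XV[of "Suc k"] X by (intro eq_vecI) auto
  obtain M where M: "\<And>k. k \<ge> M \<Longrightarrow> V k = 0\<^sub>v n"
    using coeff_vec_eventually_zero[OF v] unfolding V_def by blast
  \<comment> \<open>Descending induction on \<open>k\<close>, for all \<open>i\<close> at once: by
    symmetry the factor \<open>X\<close> in front of \<open>V (Suc k)\<close> moves to the left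
    vector and raises \<open>i\<close> by one.\<close>
  have "((X ^\<^sub>m i) *\<^sub>v q) \<bullet> V k = 0" for i k
  proof (induction "M - k" arbitrary: i k)
    case 0
    then show ?case using M[of k] Pq[of i] by simp
  next
    case (Suc m)
    have "((X ^\<^sub>m i) *\<^sub>v q) \<bullet> V k
        = ((X ^\<^sub>m i) *\<^sub>v q) \<bullet> (X *\<^sub>v V (Suc k)) + poly.coeff f (Suc k) * (((X ^\<^sub>m i) *\<^sub>v q) \<bullet> q)"
      unfolding VS[of k] using Pq[of i] XV[of "Suc k"] q
      by (simp add: scalar_prod_add_distrib[of _ n])
    also have "((X ^\<^sub>m i) *\<^sub>v q) \<bullet> (X *\<^sub>v V (Suc k)) = ((X ^\<^sub>m Suc i) *\<^sub>v q) \<bullet> V (Suc k)"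
      unfolding pow_Suc_mult_vec_left[OF X q]
      using scalar_prod_mult_mat_vec_transpose[OF X Pq V] sym by simp
    also have "\<dots> = 0" using Suc by (intro Suc.hyps) auto
    finally show ?case using iso by simp
  qed
  from this[of 0] have qV: "q \<bullet> V k = 0" for k using X q by simp
  show ?thesis
  proof (rule poly_eqI)
    fix k
    have "poly.coeff (map_vec (\<lambda>a. [:a:]) q \<bullet> v) k = q \<bullet> V k"
      using v q by (auto simp: scalar_prod_def coeff_sum V_def intro!: sum.cong)
    then show "poly.coeff (map_vec (\<lambda>a. [:a:]) q \<bullet> v) k = poly.coeff 0 k" using qV by simp
  qed
qed

section \<open>Prime powers dividing products and squares\<close>

lemma prime_elem_power_dvd_mult_cancel:
  fixes p :: "'a::algebraic_semidom"
  assumes p: "prime_elem p" and a: "\<not> p dvd a" and dvd: "p ^ k dvd a * b"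
  shows "p ^ k dvd b"
  using dvd
proof (induction k arbitrary: b)
  case (Suc k)
  have "p dvd a * b" using Suc.prems by (meson dvd_power dvd_trans zero_less_Suc)
  then obtain c where c: "b = p * c" using prime_elem_dvd_multD[OF p] a by blast
  have "p * p ^ k dvd p * (a * c)" using Suc.prems c by (simp add: ac_simps)
  then have "p ^ k dvd a * c" using p by (simp add: prime_elem_def)
  from Suc.IH[OF this] show ?case by (simp add: c mult_dvd_mono)
qed simp

text \<open>Each factor \<open>p\<close> taken out of \<open>s\<close> accounts for two factors of
  \<open>p ^ d\<close>. The exponent \<open>d - d div 2\<close> is half of \<open>d\<close> rounded
  up, which makes the case \<open>d = 1\<close> a base case of its own.\<close>

lemma prime_elem_power_dvd_square:
  fixes p :: "'a::algebraic_semidom"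
  assumes p: "prime_elem p" and dvd: "p ^ d dvd s ^ 2"
  shows "p ^ (d - d div 2) dvd s"
  using dvd
proof (induction d arbitrary: s rule: less_induct)
  case (less d)
  show ?case
  proof (cases "d = 0")
    case False
    then have "p dvd s ^ 2" using less.prems by (meson dvd_power dvd_trans neq0_conv)
    then obtain c where c: "s = p * c" using prime_elem_dvd_power[OF p] by blast
    show ?thesis
    proof (cases "d = 1")
      case True
      then show ?thesis using c by simp
    next
      case False
      with \<open>d \<noteq> 0\<close> obtain d' where d': "d = Suc (Suc d')" 
        by (metis One_nat_def not0_implies_Suc)
      have "p * p * p ^ d' dvd p * p * c ^ 2"
        using less.prems by (simp add: d' c power_mult_distrib power2_eq_square ac_simps)
      then have "p ^ d' dvd c ^ 2" using p by (auto simp: prime_elem_def)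
      then have "p ^ (d' - d' div 2) dvd c" using d' by (intro less.IH) auto
      moreover have "d - d div 2 = Suc (d' - d' div 2)" unfolding d' by linarith
      ultimately show ?thesis by (simp add: c mult_dvd_mono)
    qed
  qed simp
qed

text \<open>The cofactor is the product of the \<gamma>'s with half exponents rounded up. Each of
  these prime powers divides \<open>s\<close> when \<phi> divides its square, and they can be
  collected because the \<gamma>'s are pairwise coprime.\<close>

lemma approx_sqrt_cofactor:
  assumes "is_approx_sqrt \<phi> \<Gamma>"
  obtains \<Delta> where "\<phi> = \<Gamma> * \<Delta>" and "\<And>s. \<phi> dvd s ^ 2 \<Longrightarrow> \<Delta> dvd s"
proof -
  obtain m :: nat and \<gamma> d where inj: "inj_on \<gamma> {..<m}"
    and \<gamma>: "\<forall>i<m. monic (\<gamma> i) \<and> Factorial_Ring.irreducible (\<gamma> i) \<and> d i \<ge> 1"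
    and \<phi>: "\<phi> = (\<Prod>i<m. \<gamma> i ^ d i)" and \<Gamma>: "\<Gamma> = (\<Prod>i<m. \<gamma> i ^ (d i div 2))"
    using assms unfolding is_approx_sqrt_def by blast
  define \<delta> where "\<delta> i = \<gamma> i ^ (d i - d i div 2)" for i
  have prime: "prime_elem (\<gamma> i)" if "i < m" for i
    using \<gamma> that by (intro field_poly_irreducible_imp_prime) blast
  \<comment> \<open>Between irreducible polynomials divisibility is mutual, and mutual divisibility
    of monic polynomials is equality.\<close>
  have not_dvd: "\<not> \<gamma> i dvd \<gamma> j" if "i < m" "j < m" "i \<noteq> j" for i j
  proof
    assume dvd: "\<gamma> i dvd \<gamma> j"
    have "\<not> \<gamma> i dvd 1" using prime[OF \<open>i < m\<close>] unfolding prime_elem_def by blast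
    then have "\<gamma> j dvd \<gamma> i" using dvd \<gamma> \<open>j < m\<close> irreducibleD' by blast
    then have "\<gamma> i = \<gamma> j" using dvd \<gamma> \<open>i < m\<close> \<open>j < m\<close> poly_dvd_antisym by metis
    then show False using inj that by (auto dest: inj_onD)
  qed
  have "\<phi> = \<Gamma> * (\<Prod>i<m. \<delta> i)"
    unfolding \<phi> \<Gamma> \<delta>_def prod.distrib[symmetric] power_add[symmetric] by (intro prod.cong) auto
  moreover have "(\<Prod>i<m. \<delta> i) dvd s" if s: "\<phi> dvd s ^ 2" for s
  proof -
    have "(\<Prod>i<j. \<delta> i) dvd s" if "j \<le> m" for j
      using that
    proof (induction j)
      case (Suc j)
      then have "(\<Prod>i<j. \<delta> i) dvd s" by simp
      then obtain c where c: "s = (\<Prod>i<j. \<delta> i) * c" by (rule dvdE)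
      have "\<gamma> j ^ d j dvd \<phi>" unfolding \<phi> using Suc.prems by (intro dvd_prodI) auto
      then have "\<gamma> j ^ d j dvd s ^ 2" using s by (rule dvd_trans)
      then have "\<delta> j dvd s" unfolding \<delta>_def
        using prime Suc.prems by (intro prime_elem_power_dvd_square) auto
      \<comment> \<open>The new prime does not divide the product collected so far, so its power
        must divide the remaining factor \<open>c\<close>.\<close>
      moreover have "\<not> \<gamma> j dvd (\<Prod>i<j. \<delta> i)"
      proof
        assume "\<gamma> j dvd (\<Prod>i<j. \<delta> i)"
        then obtain i where i: "i < j" "\<gamma> j dvd \<delta> i"
          using prime_elem_dvd_prod_msetE[OF prime[of j], of "image_mset \<delta> (mset_set {..<j})"] Suc.prems
          by (auto simp: prod_unfold_prod_mset)
        then have "\<gamma> j dvd \<gamma> i" unfolding \<delta>_def using prime_elem_dvd_power prime[of j] Suc.prems by (metis Suc_le_lessD)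
        then show False using not_dvd[of j i] i Suc.prems by auto
      qed
      ultimately have "\<delta> j dvd c"
        using prime_elem_power_dvd_mult_cancel[OF prime[OF Suc_le_lessD[OF Suc.prems]]]
        unfolding c \<delta>_def[of j] by blast
      then show ?case unfolding c by simp
    qed simp
    then show ?thesis by simp
  qed
  ultimately show thesis by (rule that)
qed

text \<open>This is the statement over the residue field. The bound \<open>N\<close> may exceed the
  degree of \<Gamma>, as happens when \<open>N\<close> is the degree of a lift whose leading
  coefficient reduces to zero.\<close>

lemma approx_sqrt_annihilates_isotropic:
  fixes X :: "'k::field mat"
  assumes X: "X \<in> carrier_mat n n" and sym: "transpose_mat X = X"
    and q: "q \<in> carrier_vec n" and iso: "\<And>i. ((X ^\<^sub>m i) *\<^sub>v q) \<bullet> q = 0"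
    and \<Gamma>: "is_approx_sqrt (char_poly X) \<Gamma>" and N: "degree \<Gamma> \<le> N" and r: "r < n"
  shows "(\<Sum>k\<le>N. poly.coeff \<Gamma> k * ((X ^\<^sub>m k) *\<^sub>v q) $ r) = 0"
proof -
  define A where "A = char_poly_matrix X"
  define Q where "Q = map_vec (\<lambda>a. [:a:]) q"
  define u where "u = adj_mat A *\<^sub>v Q"
  have A: "A \<in> carrier_mat n n" using X by (simp add: A_def)
  have Q: "Q \<in> carrier_vec n" using q by (simp add: Q_def)
  note Ad = adj_mat[OF A]
  have u: "u \<in> carrier_vec n" using mult_mat_vec_carrier[OF Ad(1) Q] by (simp add: u_def)
  have detA: "det A = char_poly X" by (simp add: A_def char_poly_def)
  have nz: "det A \<noteq> 0" unfolding detA using degree_monic_char_poly[OF X] by auto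
  have symX: "X $$ (j, i) = X $$ (i, j)" if "i < n" "j < n" for i j
    using arg_cong[OF sym, of "\<lambda>M. M $$ (i, j)"] X that by auto
  have symA: "transpose_mat A = A"
    using X by (intro eq_matI) (auto simp: A_def char_poly_matrix_def symX)
  have Au: "A *\<^sub>v u = det A \<cdot>\<^sub>v Q"
  proof -
    have "A *\<^sub>v u = (det A \<cdot>\<^sub>m 1\<^sub>m n) *\<^sub>v Q"
      unfolding u_def Ad(2)[symmetric] using assoc_mult_mat_vec[OF A Ad(1) Q] by simp
    also have "\<dots> = det A \<cdot>\<^sub>v Q"
    proof (rule eq_vecI)
      fix i assume "i < dim_vec (det A \<cdot>\<^sub>v Q)"
      then have i: "i < n" using Q by simp
      have "row (det A \<cdot>\<^sub>m 1\<^sub>m n) i = det A \<cdot>\<^sub>v unit_vec n i" using i by (intro eq_vecI) auto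
      then show "((det A \<cdot>\<^sub>m 1\<^sub>m n) *\<^sub>v Q) $ i = (det A \<cdot>\<^sub>v Q) $ i" using Q i by simp
    qed (use Q in simp)
    finally show ?thesis .
  qed
  have Qu: "Q \<bullet> u = 0"
    using cyclic_isotropic_solution[OF X sym q u iso] Au unfolding A_def Q_def by blast
  obtain \<Delta> where \<Delta>: "char_poly X = \<Gamma> * \<Delta>"
    and dvd: "\<And>s. char_poly X dvd s ^ 2 \<Longrightarrow> \<Delta> dvd s"
    using approx_sqrt_cofactor[OF \<Gamma>] by blast
  have "\<exists>v. u $ i = \<Delta> * v" if i: "i < n" for i
  proof -
    let ?l = "unit_vec n i :: 'k poly vec"
    have l: "?l \<in> carrier_vec n" by simp
    have lu: "?l \<bullet> u = u $ i" using u i by simp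
    have "Q \<bullet> (adj_mat A *\<^sub>v ?l) = u \<bullet> ?l"
      unfolding scalar_prod_mult_mat_vec_transpose[OF Ad(1) Q l] transpose_adj_mat[OF A symA nz] u_def ..
    also have "\<dots> = u $ i" using u i by simp
    \<comment> \<open>For the unit vector \<open>?l\<close>, both mixed entries of the minor equal
      \<open>u $ i\<close>, the second by symmetry of the adjugate; the diagonal product vanishes
      because \<open>Q \<bullet> u = 0\<close>.\<close>
    finally have "det A dvd - (u $ i * u $ i)"
      using det_dvd_adj_mat_minor[OF A nz Q l] Qu lu unfolding u_def[symmetric] by simp
    then show ?thesis using dvd[of "u $ i"] unfolding detA by (auto simp: power2_eq_square elim: dvdE)
  qed
  then obtain c where c: "\<And>i. i < n \<Longrightarrow> u $ i = \<Delta> * c i" by metis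
  define v where "v = vec n c"
  have v: "v \<in> carrier_vec n" by (simp add: v_def)
  have uv: "u = \<Delta> \<cdot>\<^sub>v v" using u c by (intro eq_vecI) (auto simp: v_def)
  have \<Delta>0: "\<Delta> \<noteq> 0" using nz unfolding detA \<Delta> by auto
  have Av: "A *\<^sub>v v \<in> carrier_vec n" using mult_mat_vec_carrier[OF A v] .
  \<comment> \<open>Both sides of \<open>A u = \<phi> Q\<close> now carry the factor \<Delta>;
    cancelling it leaves \<Gamma> in place of \<phi>.\<close>
  have "\<Delta> \<cdot>\<^sub>v (A *\<^sub>v v) = \<Delta> \<cdot>\<^sub>v (\<Gamma> \<cdot>\<^sub>v Q)"
    using Au unfolding uv detA \<Delta> mult_mat_vec_smult[OF A v] by (simp add: smult_smult_assoc mult.commute)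
  then have "A *\<^sub>v v = \<Gamma> \<cdot>\<^sub>v Q"
  proof (intro eq_vecI)
    fix i assume eq: "\<Delta> \<cdot>\<^sub>v (A *\<^sub>v v) = \<Delta> \<cdot>\<^sub>v (\<Gamma> \<cdot>\<^sub>v Q)" and "i < dim_vec (\<Gamma> \<cdot>\<^sub>v Q)"
    then have i: "i < n" using Q by simp
    have "\<Delta> * (A *\<^sub>v v) $ i = \<Delta> * (\<Gamma> \<cdot>\<^sub>v Q) $ i"
      using arg_cong[OF eq, of "\<lambda>x. x $ i"] i A Q by (simp del: index_mult_mat_vec)
    then show "(A *\<^sub>v v) $ i = (\<Gamma> \<cdot>\<^sub>v Q) $ i" using \<Delta>0 by simp
  qed (use A Q in auto)
  then show ?thesis
    using annihilates_if_char_poly_matrix_mult_eq[OF X q v _ N r] unfolding A_def Q_def by blast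
qed

subsection \<open>Dedekind domains\<close>

lemma ideal_class_ring_iff:
  "ideal I (class_ring :: 'a::comm_ring_1 ring)
    \<longleftrightarrow> 0 \<in> I \<and> (\<forall>x\<in>I. \<forall>y\<in>I. x + y \<in> I) \<and> (\<forall>x\<in>I. \<forall>r. r * x \<in> I)" (is "?L \<longleftrightarrow> ?R")
proof
  assume ?L
  interpret ideal I "class_ring :: 'a ring" by fact
  show ?R using zero_closed a_closed I_l_closed by auto
next
  assume R: ?R
  show ?L
  proof (rule idealI)
    show "ring (class_ring :: 'a ring)" by (rule class_ring.ring_axioms)
    show "subgroup I (add_monoid (class_ring :: 'a ring))"
    proof
      fix x assume x: "x \<in> I"
      have "inv\<^bsub>add_monoid class_ring\<^esub> x = - x"
        using class_ring_simps(8)[where 'a = 'a] by (simp add: a_inv_def fun_eq_iff)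
      moreover have "- 1 * x \<in> I" using R x by blast
      ultimately show "inv\<^bsub>add_monoid class_ring\<^esub> x \<in> I" by simp
    qed (use R in auto)
  qed (use R in \<open>auto simp: mult.commute\<close>)
qed

lemma ideal_power_0 [simp]: "ideal_power I 0 = UNIV"
  by (simp add: ideal_power_def ideals_set_def)

lemma ideal_power_Suc:
  "ideal_power I (Suc k) = ideal_prod class_ring (ideal_power I k) I"
  by (simp add: ideal_power_def ideals_set_def nat_pow_def)

lemma ideal_ideal_power:
  fixes I :: "'a::comm_ring_1 set"
  assumes "ideal I class_ring"
  shows "ideal (ideal_power I k) class_ring"
proof (induction k)
  case 0
  show ?case by (simp add: ideal_class_ring_iff)
next
  case (Suc k)
  then show ?case unfolding ideal_power_Suc
    using ring.ideal_prod_is_ideal[OF class_ring.ring_axioms] assms by blast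
qed

lemma ideal_dvd_imp_subset:
  fixes B :: "'a::comm_ring_1 set"
  assumes "ideal_dvd B A" and "ideal B class_ring"
  shows "A \<subseteq> B"
proof -
  obtain C where C: "ideal C class_ring" and A: "A = ideal_prod class_ring B C"
    using assms(1) by (auto simp: ideal_dvd_def factor_def ideals_set_def)
  show ?thesis using ring.ideal_prod_inter[OF class_ring.ring_axioms assms(2) C] unfolding A by blast
qed

section \<open>Chain conditions and integrality\<close>

lemma noetherian_incseq_stationary:
  fixes I :: "nat \<Rightarrow> 'a::idom set"
  assumes noeth: "noetherian_ring (class_ring :: 'a ring)"
    and ideal: "\<And>m. ideal (I m) class_ring" and mono: "incseq I"
  obtains m where "I (Suc m) = I m"
proof -
  \<comment> \<open>In a noetherian ring the union of a nonempty chain of ideals is a member of the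
    chain.\<close>
  have "\<Union>(range I) \<in> range I"
  proof (rule noetherian_ring.ideal_chain_is_trivial[OF noeth])
    show "subset.chain {J. ideal J class_ring} (range I)"
      using ideal mono[THEN incseqD] unfolding subset.chain_def by (auto) (meson nat_le_linear subsetD)+
  qed simp
  then obtain m where "\<Union>(range I) = I m" by blast
  then have "I (Suc m) \<subseteq> I m" by blast
  then show thesis using that mono by (metis incseq_SucD subset_antisym)
qed

text \<open>Zorn's lemma applies: a nonempty chain in \<open>S\<close> contains its own union, and
  any element of \<open>S\<close> bounds the empty chain.\<close>

lemma noetherian_maximal_element:
  fixes S :: "'a::idom set set"
  assumes noeth: "noetherian_ring (class_ring :: 'a ring)"
    and ideal: "\<And>I. I \<in> S \<Longrightarrow> ideal I class_ring" and ne: "S \<noteq> {}"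
  obtains M where "M \<in> S" and "\<And>I. I \<in> S \<Longrightarrow> M \<subseteq> I \<Longrightarrow> I = M"
proof -
  have "\<exists>M\<in>S. \<forall>I\<in>S. M \<subseteq> I \<longrightarrow> I = M"
  proof (rule subset_Zorn)
    fix C assume C: "subset.chain S C"
    show "\<exists>U\<in>S. \<forall>I\<in>C. I \<subseteq> U"
    proof (cases "C = {}")
      case False
      have "subset.chain {J. ideal J class_ring} C"
        using C ideal unfolding subset.chain_def by blast
      then have "\<Union>C \<in> C" using noetherian_ring.ideal_chain_is_trivial[OF noeth False] by blast
      moreover have "\<Union>C \<in> S" using calculation C unfolding subset.chain_def by auto
      ultimately show ?thesis by (intro bexI[of _ "\<Union>C"]) auto
    qed (use ne in blast)
  qed
  then show thesis using that by blast
qed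

text \<open>By the ascending chain condition on the ideals generated by \<open>x, t x, \<dots>, t^m x\<close>, some
  \<open>t^(m+1) x\<close> is a combination of lower terms, which is an integral equation for \<open>t\<close>.\<close>

lemma almost_integral_imp_integral:
  fixes x :: "'a::idom" and t :: "'a fract"
  assumes noeth: "noetherian_ring (class_ring :: 'a ring)"
    and closed: "integrally_closed TYPE('a)"
    and x: "x \<noteq> 0" and mem: "\<And>m. t ^ m * to_fract x \<in> range to_fract"
  shows "t \<in> range to_fract"
proof -
  define I where "I m = {a. \<exists>c. to_fract a = (\<Sum>i\<le>m. to_fract (c i) * t ^ i) * to_fract x}" for m
  have I_memI: "a \<in> I m"
    if "to_fract a = (\<Sum>i\<le>m. to_fract (c i) * t ^ i) * to_fract x" for a m c
    using that unfolding I_def by blast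
  have "ideal (I m) class_ring" for m
  proof -
    have "0 \<in> I m" unfolding I_def by (auto intro!: exI[of _ "\<lambda>_. 0"])
    moreover have "a + b \<in> I m" if ab: "a \<in> I m" "b \<in> I m" for a b
    proof -
      obtain c d where "to_fract a = (\<Sum>i\<le>m. to_fract (c i) * t ^ i) * to_fract x"
        and "to_fract b = (\<Sum>i\<le>m. to_fract (d i) * t ^ i) * to_fract x"
        using ab by (auto simp: I_def)
      then have "to_fract (a + b) = (\<Sum>i\<le>m. to_fract (c i + d i) * t ^ i) * to_fract x"
        by (simp add: distrib_right sum.distrib)
      then show ?thesis by (rule I_memI)
    qed
    moreover have "r * a \<in> I m" if a: "a \<in> I m" for a r
    proof -
      obtain c where "to_fract a = (\<Sum>i\<le>m. to_fract (c i) * t ^ i) * to_fract x"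
        using a by (auto simp: I_def)
      then have "to_fract (r * a) = (\<Sum>i\<le>m. to_fract (r * c i) * t ^ i) * to_fract x"
        by (simp add: sum_distrib_left mult.assoc)
      then show ?thesis by (rule I_memI)
    qed
    ultimately show ?thesis by (auto simp: ideal_class_ring_iff)
  qed
  moreover have "incseq I"
  proof (rule incseq_SucI, rule subsetI)
    fix m a assume "a \<in> I m"
    then obtain c where "to_fract a = (\<Sum>i\<le>m. to_fract (c i) * t ^ i) * to_fract x"
      by (auto simp: I_def)
    then have "to_fract a = (\<Sum>i\<le>Suc m. to_fract ((c(Suc m := 0)) i) * t ^ i) * to_fract x"
      by simp
    then show "a \<in> I (Suc m)" by (rule I_memI)
  qed
  ultimately obtain m where m: "I (Suc m) = I m"
    using noetherian_incseq_stationary[OF noeth] by blast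
  obtain y where y: "t ^ Suc m * to_fract x = to_fract y" using mem[of "Suc m"] by blast
  have "to_fract y = (\<Sum>i\<le>Suc m. to_fract (if i = Suc m then 1 else 0) * t ^ i) * to_fract x"
    unfolding y[symmetric] by simp
  then have "y \<in> I (Suc m)" by (rule I_memI)
  then obtain c where c: "to_fract y = (\<Sum>i\<le>m. to_fract (c i) * t ^ i) * to_fract x"
    unfolding m by (auto simp: I_def)
  \<comment> \<open>Cancelling \<open>x\<close> turns membership of \<open>t^(m+1) x\<close> in the
    smaller ideal into the integral equation.\<close>
  have t: "t ^ Suc m = (\<Sum>i\<le>m. to_fract (c i) * t ^ i)"
    using c x unfolding y[symmetric] by simp
  define p where "p = Polynomial.monom 1 (Suc m) - (\<Sum>i\<le>m. Polynomial.monom (c i) i)"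
  have deg: "degree (\<Sum>i\<le>m. Polynomial.monom (c i) i) < Suc m"
    by (intro degree_sum_less) (auto intro: le_less_trans[OF degree_monom_le])
  have "degree p = Suc m" unfolding p_def
    using deg by (simp add: degree_monom_eq diff_conv_add_uminus degree_add_eq_left del: add_uminus_conv_diff)
  then have "monic p" unfolding p_def using deg by (simp add: coeff_eq_0)
  moreover have "poly (map_poly to_fract p) t = 0"
  proof -
    have "map_poly to_fract p = Polynomial.monom 1 (Suc m) - (\<Sum>i\<le>m. Polynomial.monom (to_fract (c i)) i)"
      unfolding p_def
      by (intro poly_eqI) (auto simp: coeff_map_poly Polynomial.coeff_sum if_distrib[of to_fract] intro!: sum.cong)
    then show ?thesis using t by (simp add: poly_monom poly_sum)
  qed
  ultimately show ?thesis using closed unfolding integrally_closed_def by blast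
qed

interpretation to_fract_hom: inj_comm_ring_hom to_fract
  by unfold_locales auto

lemma range_to_fract_closed:
  assumes "x \<in> range to_fract" "y \<in> range to_fract"
  shows "x + y \<in> range to_fract" "x * y \<in> range to_fract"
  using assms by (auto simp flip: to_fract_add to_fract_mult)

lemma ideal_power_1:
  fixes I :: "'a::comm_ring_1 set"
  assumes "ideal I class_ring"
  shows "ideal_power I 1 = I"
proof -
  have "ideal_prod class_ring I (carrier class_ring) = I"
    by (rule ring.ideal_prod_one[OF class_ring.ring_axioms assms])
  then show ?thesis
    using cring.ideal_prod_commute[OF class_cring.cring_axioms assms ring.oneideal[OF class_ring.ring_axioms]]
    by (simp add: ideal_power_Suc)
qed

lemma ideal_power_antimono:
  fixes I :: "'a::comm_ring_1 set"
  assumes I: "ideal I class_ring" and "j \<le> k"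
  shows "ideal_power I k \<subseteq> ideal_power I j"
  using \<open>j \<le> k\<close>
proof (induction k rule: dec_induct)
  case (step k)
  then show ?case unfolding ideal_power_Suc
    using ring.ideal_prod_inter[OF class_ring.ring_axioms ideal_ideal_power[OF I] I, of k] by blast
qed simp

section \<open>Inverting a nonzero prime ideal\<close>

lemma primeideal_class_ring_D:
  fixes P :: "'a::comm_ring_1 set"
  assumes "primeideal P class_ring"
  shows "ideal P class_ring" and "1 \<notin> P" and "a * b \<in> P \<Longrightarrow> a \<in> P \<or> b \<in> P"
proof -
  interpret primeideal P "class_ring :: 'a ring" by fact
  show "ideal P class_ring" by (rule is_ideal)
  show "1 \<notin> P" using one_imp_carrier I_notcarr by auto
  show "a * b \<in> P \<Longrightarrow> a \<in> P \<or> b \<in> P" using I_prime[of a b] by simp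
qed

text \<open>Among the colon ideals \<open>(b R : y)\<close> contained in \<open>P\<close>, where \<open>0 \<noteq> b \<in> P\<close>, a maximal one is a
  nonzero prime, hence equal to \<open>P\<close>; the fraction \<open>y / b\<close> then has the required property.\<close>

lemma dedekind_inverse_element:
  fixes P :: "'a::idom set"
  assumes ded: "dedekind_domain TYPE('a)" and prime: "primeideal P class_ring" and nz: "P \<noteq> {0}"
  obtains t :: "'a fract" where "t \<notin> range to_fract"
    and "\<And>x. x \<in> P \<Longrightarrow> t * to_fract x \<in> range to_fract"
proof -
  note P = primeideal_class_ring_D[OF prime]
  have noeth: "noetherian_ring (class_ring :: 'a ring)"
    using ded unfolding dedekind_domain_def noetherian_domain_def by blast
  obtain b where b: "b \<in> P" "b \<noteq> 0" using nz P(1) by (auto simp: ideal_class_ring_iff)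
  define J where "J y = {x. b dvd x * y}" for y
  have idealJ: "ideal (J y) class_ring" for y
    unfolding ideal_class_ring_iff J_def by (auto simp: distrib_right mult.assoc)
  \<comment> \<open>\<open>J 1\<close> is the principal ideal of \<open>b\<close>, contained in
    \<open>P\<close> because \<open>b\<close> lies in \<open>P\<close>; so there are
    candidates.\<close>
  have "J 1 \<in> {J y |y. J y \<subseteq> P}"
    using b P(1) by (auto simp: J_def ideal_class_ring_iff mult.commute elim!: dvdE intro!: exI[of _ 1])
  then have ne: "{J y |y. J y \<subseteq> P} \<noteq> {}" by blast
  obtain M where M: "M \<in> {J y |y. J y \<subseteq> P}"
    and max: "\<And>I. I \<in> {J y |y. J y \<subseteq> P} \<Longrightarrow> M \<subseteq> I \<Longrightarrow> I = M"
  proof (rule noetherian_maximal_element[OF noeth, of "{J y |y. J y \<subseteq> P}"])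
    show "ideal I class_ring" if "I \<in> {J y |y. J y \<subseteq> P}" for I
      using that idealJ by auto
  qed (use ne in auto)
  from M obtain y where y: "M = J y" "J y \<subseteq> P" by blast
  \<comment> \<open>Colon ideals only grow when \<open>y\<close> is multiplied, so maximality forces
    equality as long as the larger one stays inside \<open>P\<close>.\<close>
  have max': "J (z * y) = J y" if "J (z * y) \<subseteq> P" for z
  proof -
    have "J y \<subseteq> J (z * y)"
    proof
      fix x assume "x \<in> J y"
      then have "b dvd z * (x * y)" by (simp add: J_def)
      then show "x \<in> J (z * y)" by (simp add: J_def mult.left_commute)
    qed
    moreover have "J (z * y) \<in> {J y |y. J y \<subseteq> P}" using that by blast
    ultimately show ?thesis using max[of "J (z * y)"] unfolding y(1) by simp
  qed
  have "primeideal (J y) class_ring"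
  proof (rule primeidealI)
    show "cring (class_ring :: 'a ring)" by (rule class_cring.cring_axioms)
    show "carrier class_ring \<noteq> J y" using y P(2) by auto
    fix x z assume "x \<otimes>\<^bsub>class_ring\<^esub> z \<in> J y"
    then have xz: "x * z \<in> J y" by simp
    show "x \<in> J y \<or> z \<in> J y"
    proof (cases "J (x * y) \<subseteq> P")
      case True
      then have "J (x * y) = J y" by (rule max')
      moreover have "z \<in> J (x * y)" using xz by (simp add: J_def ac_simps)
      ultimately show ?thesis by blast
    next
      case False
      \<comment> \<open>An element \<open>v\<close> outside \<open>P\<close> may be multiplied onto
        \<open>y\<close>: as \<open>P\<close> is prime, \<open>J (v * y)\<close> stays inside
        \<open>P\<close>, so it equals \<open>J y\<close>, and it contains \<open>x\<close>.\<close>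
      then obtain v where v: "v \<in> J (x * y)" "v \<notin> P" by blast
      have "J (v * y) \<subseteq> P"
      proof
        fix g assume "g \<in> J (v * y)"
        then have "g * v \<in> J y" by (simp add: J_def ac_simps)
        then show "g \<in> P" using y P(3) v by blast
      qed
      then have "J (v * y) = J y" by (rule max')
      moreover have "x \<in> J (v * y)" using v by (simp add: J_def ac_simps)
      ultimately show ?thesis by blast
    qed
  qed (rule idealJ)
  moreover have "b \<in> J y" by (simp add: J_def)
  with b have "J y \<noteq> {0}" by blast
  ultimately have "maximalideal (J y) class_ring" using ded unfolding dedekind_domain_def by blast
  then have "P = J y \<or> P = UNIV"
    using maximalideal.I_maximal[OF _ P(1) y(2)] by auto
  then have PJ: "P = J y" using P(2) by blast
  show thesis
  proof
    show "to_fract y / to_fract b \<notin> range to_fract"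
    proof
      assume "to_fract y / to_fract b \<in> range to_fract"
      then obtain c where "to_fract y / to_fract b = to_fract c" by blast
      then have "to_fract y = to_fract (c * b)" using b by (simp add: field_simps)
      then have "1 \<in> J y" by (simp add: J_def del: to_fract_mult)
      then show False using y P(2) by blast
    qed
    fix x assume "x \<in> P"
    then obtain c where "x * y = b * c" unfolding PJ J_def by blast
    then have "to_fract x * to_fract y = to_fract b * to_fract c" by (metis to_fract_mult)
    then have "to_fract y / to_fract b * to_fract x = to_fract c" using b by (simp add: field_simps)
    then show "to_fract y / to_fract b * to_fract x \<in> range to_fract" by simp
  qed
qed

text \<open>The fraction \<open>t\<close> is the inverse of a uniformizer at \<open>P\<close>, and is integral at all other primes.\<close>

lemma dedekind_inverse_uniformizer:
  fixes P :: "'a::idom set"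
  assumes ded: "dedekind_domain TYPE('a)" and prime: "primeideal P class_ring" and nz: "P \<noteq> {0}"
  obtains t :: "'a fract" where "t \<notin> range to_fract"
    and "\<And>k x. x \<in> ideal_power P k \<longleftrightarrow> t ^ k * to_fract x \<in> range to_fract"
proof -
  note P = primeideal_class_ring_D[OF prime]
  have noeth: "noetherian_ring (class_ring :: 'a ring)" and closed: "integrally_closed TYPE('a)"
    and maximal: "maximalideal P class_ring"
    using ded prime nz unfolding dedekind_domain_def noetherian_domain_def by blast+
  obtain t :: "'a fract" where t: "t \<notin> range to_fract"
    and tP: "\<And>x. x \<in> P \<Longrightarrow> t * to_fract x \<in> range to_fract"
    using dedekind_inverse_element[OF assms] by blast
  obtain b where b: "b \<in> P" "b \<noteq> 0" using nz P(1) by (auto simp: ideal_class_ring_iff)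
  \<comment> \<open>If \<open>t\<close> mapped \<open>P\<close> into itself, then all
    \<open>t^m b\<close> would be in the ring and \<open>t\<close> would be integral. Hence some
    \<open>p\<close> in \<open>P\<close> is carried to an element \<open>u\<close> outside
    \<open>P\<close>; locally at \<open>P\<close>, \<open>p\<close> is a uniformizer.\<close>
  have "\<exists>p u. p \<in> P \<and> u \<notin> P \<and> t * to_fract p = to_fract u"
  proof (rule ccontr)
    assume no: "\<not> ?thesis"
    have "\<exists>c\<in>P. t ^ m * to_fract b = to_fract c" for m
    proof (induction m)
      case (Suc m)
      then obtain c where c: "c \<in> P" "t ^ m * to_fract b = to_fract c" by blast
      then obtain d where "t * to_fract c = to_fract d" using tP by blast
      with c no show ?case by (auto simp: mult.assoc)
    qed (use b in auto)
    then have "t \<in> range to_fract" using almost_integral_imp_integral[OF noeth closed b(2)] by blast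
    with t show False ..
  qed
  then obtain p u where p: "p \<in> P" and u: "u \<notin> P" and tp: "t * to_fract p = to_fract u" by blast
  have in_range: "t ^ k * to_fract x \<in> range to_fract" if "x \<in> ideal_power P k" for k x
    using that
  proof (induction k arbitrary: x)
    case (Suc k)
    from Suc.prems[unfolded ideal_power_Suc] show ?case
    proof (induction x rule: ideal_prod.induct)
      case (prod i j)
      then show ?case
        using range_to_fract_closed(2)[OF Suc.IH[OF prod(1)] tP[OF prod(2)]] by (simp add: ac_simps)
    next
      case (sum x y)
      then show ?case using range_to_fract_closed(1)[OF sum.IH] by (simp add: distrib_left)
    qed
  qed simp
  \<comment> \<open>Since \<open>P\<close> is maximal, \<open>u\<close> is a unit modulo
    \<open>P\<close>, that is, \<open>1 = r u + q\<close> with \<open>q\<close> in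
    \<open>P\<close>.\<close>
  have cancel: "x \<in> ideal_power P k" if ux: "u * x \<in> ideal_power P k" for x k
  proof -
    let ?J = "{r * u + q | r q. q \<in> P}"
    have "ideal ?J class_ring"
      unfolding ideal_class_ring_iff
    proof (intro conjI ballI allI)
      have "0 = 0 * u + 0 \<and> 0 \<in> P" using P(1) by (simp add: ideal_class_ring_iff)
      then show "0 \<in> ?J" by blast
      fix x y assume "x \<in> ?J" "y \<in> ?J"
      then obtain r q r' q' where "x = r * u + q" "q \<in> P" "y = r' * u + q'" "q' \<in> P" by blast
      then have "x + y = (r + r') * u + (q + q') \<and> q + q' \<in> P"
        using P(1) by (simp add: ideal_class_ring_iff algebra_simps)
      then show "x + y \<in> ?J" by blast
    next
      fix x c assume "x \<in> ?J"
      then obtain r q where "x = r * u + q" "q \<in> P" by blast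
      then have "c * x = (c * r) * u + c * q \<and> c * q \<in> P"
        using P(1) by (simp add: ideal_class_ring_iff distrib_left mult.assoc)
      then show "c * x \<in> ?J" by blast
    qed
    moreover have "P \<subseteq> ?J"
    proof
      fix x assume "x \<in> P"
      then have "x = 0 * u + x \<and> x \<in> P" by simp
      then show "x \<in> ?J" by blast
    qed
    moreover have "u \<in> ?J"
    proof -
      have "u = 1 * u + 0 \<and> 0 \<in> P" using P(1) by (simp add: ideal_class_ring_iff)
      then show ?thesis by blast
    qed
    ultimately have "?J = P \<or> ?J = UNIV" and "u \<in> ?J"
      using maximalideal.I_maximal[OF maximal, of ?J] by simp_all
    then have "?J = UNIV" using u by blast
    then obtain r q where one: "1 = r * u + q" and q: "q \<in> P" by blast
    \<comment> \<open>In \<open>x = r (u x) + q x\<close> the first summand lies in the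
      \<open>k\<close>-th power of \<open>P\<close>, and the second in one power more than is known
      for \<open>x\<close>. Membership thus climbs from power 0 to power \<open>k\<close>.\<close>
    have "j \<le> k \<Longrightarrow> x \<in> ideal_power P j" for j
    proof (induction j)
      case (Suc j)
      have "r * (u * x) \<in> ideal_power P k"
        using ux ideal_ideal_power[OF P(1), of k] by (simp add: ideal_class_ring_iff)
      then have "r * (u * x) \<in> ideal_power P (Suc j)"
        using ideal_power_antimono[OF P(1) Suc.prems] by blast
      moreover have "x * q \<in> ideal_power P (Suc j)"
        unfolding ideal_power_Suc using ideal_prod.prod[of x "ideal_power P j" q P class_ring] Suc q by simp
      ultimately have "r * (u * x) + x * q \<in> ideal_power P (Suc j)"
        using ideal_ideal_power[OF P(1), of "Suc j"] by (simp add: ideal_class_ring_iff)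
      moreover have "x = (r * u + q) * x" unfolding one[symmetric] by simp
      then have "r * (u * x) + x * q = x" by (simp add: algebra_simps)
      ultimately show ?case by simp
    qed simp
    then show ?thesis by blast
  qed
  \<comment> \<open>With \<open>y = t^k x\<close> one has \<open>u^k x = p^k y\<close>, which lies
    in the \<open>k\<close>-th power of \<open>P\<close>; the factors \<open>u\<close> are then
    cancelled one by one.\<close>
  have "x \<in> ideal_power P k" if tx: "t ^ k * to_fract x \<in> range to_fract" for k x
  proof -
    obtain y where y: "t ^ k * to_fract x = to_fract y" using tx by blast
    have pk: "p ^ k * y \<in> ideal_power P k"
    proof -
      have "p ^ k \<in> ideal_power P k"
      proof (induction k)
        case (Suc k)
        then show ?case unfolding ideal_power_Suc
          using ideal_prod.prod[of "p ^ k" "ideal_power P k" p P class_ring] p by (simp add: mult.commute)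
      qed simp
      then have "y * p ^ k \<in> ideal_power P k"
        using ideal_ideal_power[OF P(1), of k] unfolding ideal_class_ring_iff by blast
      then show ?thesis by (simp add: mult.commute)
    qed
    have "to_fract u ^ k * to_fract x = to_fract p ^ k * to_fract y"
      unfolding tp[symmetric] y[symmetric] by (simp add: power_mult_distrib ac_simps)
    then have "to_fract (u ^ k * x) = to_fract (p ^ k * y)" by (simp add: to_fract_hom.hom_power)
    then have "u ^ k * x \<in> ideal_power P k" using pk by (simp del: to_fract_mult)
    moreover have "u ^ j * x \<in> ideal_power P k \<Longrightarrow> x \<in> ideal_power P k" for j
    proof (induction j)
      case (Suc j)
      then show ?case using cancel[of "u ^ j * x" k] by (simp add: mult.assoc)
    qed simp
    ultimately show ?thesis by blast
  qed
  then show thesis using that t in_range by blast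
qed

subsection \<open>The level of a matrix\<close>

lemma common_denominator:
  fixes S :: "'a::idom fract set"
  assumes "finite S"
  obtains a where "a \<noteq> 0" and "\<And>x. x \<in> S \<Longrightarrow> to_fract a * x \<in> range to_fract"
proof -
  have "\<exists>a. a \<noteq> 0 \<and> (\<forall>x\<in>S. to_fract a * x \<in> range to_fract)"
    using assms
  proof induction
    case (insert x S)
    then obtain a where a: "a \<noteq> 0" "\<forall>x\<in>S. to_fract a * x \<in> range to_fract" by blast
    obtain c d where x: "x = to_fract c / to_fract d" and d: "d \<noteq> 0"
      by (cases x) (auto simp: Fract_conv_to_fract)
    have "to_fract (d * a) * y \<in> range to_fract" if y: "y \<in> insert x S" for y
    proof (cases "y = x")
      case True
      then have "to_fract (d * a) * y = to_fract (a * c)" using d x by simp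
      then show ?thesis by blast
    next
      case False
      then have "to_fract d * (to_fract a * y) \<in> range to_fract"
        using a y range_to_fract_closed(2) by blast
      then show ?thesis by (simp add: mult.assoc)
    qed
    then show ?case using a d by (intro exI[of _ "d * a"]) auto
  qed (auto intro: exI[of _ 1])
  then show thesis using that by blast
qed

lemma integral_mats_iff:
  "M \<in> integral_mats n \<longleftrightarrow>
    M \<in> carrier_mat n n \<and> (\<forall>i<n. \<forall>j<n. M $$ (i, j) \<in> range to_fract)"
proof
  assume R: "M \<in> carrier_mat n n \<and> (\<forall>i<n. \<forall>j<n. M $$ (i, j) \<in> range to_fract)"
  then obtain f where f: "\<And>i j. i < n \<Longrightarrow> j < n \<Longrightarrow> M $$ (i, j) = to_fract (f i j)"
    unfolding image_iff by metis
  have "M = map_mat to_fract (mat n n (\<lambda>(i, j). f i j))"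
    using R f by (intro eq_matI) auto
  then show "M \<in> integral_mats n" unfolding integral_mats_def by auto
qed (auto simp: integral_mats_def)

lemma level_iff:
  assumes "Q \<in> carrier_mat n n"
  shows "r \<in> level Q \<longleftrightarrow> (\<forall>i<n. \<forall>j<n. to_fract r * Q $$ (i, j) \<in> range to_fract)"
  using assms by (auto simp: level_def integral_mats_iff)

text \<open>Starting from any nonzero element of the level, multiply by \<open>t\<close> as long as this stays in the
  level; as \<open>t\<close> is not integral, this stops.\<close>

lemma level_primitive_element:
  fixes P :: "'a::idom set" and t :: "'a fract"
  assumes noeth: "noetherian_ring (class_ring :: 'a ring)" and closed: "integrally_closed TYPE('a)"
    and t: "t \<notin> range to_fract" and tP: "\<And>x. x \<in> P \<Longrightarrow> t * to_fract x \<in> range to_fract"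
    and Q: "Q \<in> carrier_mat n n" and sub: "level Q \<subseteq> P"
  shows "\<exists>s\<in>level Q. \<exists>i<n. \<exists>j<n. \<exists>x. to_fract s * Q $$ (i, j) = to_fract x \<and> x \<notin> P"
proof (rule ccontr)
  assume "\<not> ?thesis"
  then have no: "x \<in> P" if "s \<in> level Q" "i < n" "j < n" "to_fract s * Q $$ (i, j) = to_fract x" for s i j x
    using that by blast
  \<comment> \<open>A common denominator of the entries of \<open>Q\<close>.\<close>
  obtain a where a: "a \<noteq> 0" "a \<in> level Q"
  proof -
    let ?S = "(\<lambda>(i, j). Q $$ (i, j)) ` ({..<n} \<times> {..<n})"
    have "finite ?S" by simp
    then obtain a where "a \<noteq> 0" "\<And>x. x \<in> ?S \<Longrightarrow> to_fract a * x \<in> range to_fract"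
      using common_denominator by blast
    then show thesis by (intro that[of a]) (auto simp: level_iff[OF Q])
  qed
  have "\<exists>s\<in>level Q. t ^ m * to_fract a = to_fract s" for m
  proof (induction m)
    case (Suc m)
    then obtain s where s: "s \<in> level Q" "t ^ m * to_fract a = to_fract s" by blast
    \<comment> \<open>The level is contained in \<open>P\<close>, so \<open>t s\<close> is again in
      the ring; by the contrary assumption the entries of \<open>s Q\<close> lie in \<open>P\<close>
      as well, so \<open>t s\<close> is in the level.\<close>
    obtain s' where s': "t * to_fract s = to_fract s'" using tP sub s by blast
    have "s' \<in> level Q"
      unfolding level_iff[OF Q]
    proof (intro allI impI)
      fix i j assume ij: "i < n" "j < n"
      obtain x where x: "to_fract s * Q $$ (i, j) = to_fract x" using s ij unfolding level_iff[OF Q] by blast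
      have "t * to_fract x \<in> range to_fract" using no[OF s(1) ij x] tP by blast
      then show "to_fract s' * Q $$ (i, j) \<in> range to_fract"
        unfolding s'[symmetric] x[symmetric] by (simp add: mult.assoc)
    qed
    then show ?case using s s' by (auto simp: mult.assoc)
  qed (use a in auto)
  then have "t \<in> range to_fract" using almost_integral_imp_integral[OF noeth closed a(1)] by blast
  with t show False ..
qed

subsection \<open>Krylov spaces\<close>

lemma vec_cong0_iff: "vec_cong0 v I \<longleftrightarrow> (\<forall>i<dim_vec v. v $ i \<in> I)"
  by (auto simp: vec_cong0_def vec_set_def)

lemma index_mult_mat_vec_sum:
  "A \<in> carrier_mat m n \<Longrightarrow> v \<in> carrier_vec n \<Longrightarrow> i < m \<Longrightarrow>
    (A *\<^sub>v v) $ i = (\<Sum>j<n. A $$ (i, j) * v $ j)"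
  by (auto simp: scalar_prod_def lessThan_atLeast0 intro!: sum.cong)

lemma pow_mat_intertwine:
  assumes X: "X \<in> carrier_mat n n" and Y: "Y \<in> carrier_mat n n" and A: "A \<in> carrier_mat n n"
    and XA: "X * A = A * Y"
  shows "X ^\<^sub>m i * A = A * Y ^\<^sub>m i"
proof (induction i)
  case (Suc i)
  have Xi: "X ^\<^sub>m i \<in> carrier_mat n n" and Yi: "Y ^\<^sub>m i \<in> carrier_mat n n" using X Y by auto
  have "X ^\<^sub>m Suc i * A = X ^\<^sub>m i * (A * Y)"
    using assoc_mult_mat[OF Xi X A] XA by simp
  also have "\<dots> = A * Y ^\<^sub>m i * Y"
    unfolding assoc_mult_mat[OF Xi A Y, symmetric] Suc ..
  finally show ?case using assoc_mult_mat[OF A Yi Y] by simp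
qed (use X Y A in simp)

text \<open>As \<open>X^i A = A Y^i\<close>, the power \<open>X^i\<close> maps column
  \<open>j\<close> of \<open>A\<close> to \<open>A\<close> times column \<open>j\<close> of
  \<open>Y^i\<close>. The Krylov space of a column therefore stays inside the image of
  \<open>A\<close>.\<close>

lemma krylov_intertwine:
  assumes X: "X \<in> carrier_mat n n" and Y: "Y \<in> carrier_mat n n" and A: "A \<in> carrier_mat n n"
    and XA: "X * A = A * Y" and j: "j < n" and q: "q \<in> krylov X [col A j]"
  obtains v where "v \<in> carrier_vec n" and "q = A *\<^sub>v v"
proof -
  obtain c where c: "q = vec n (\<lambda>r. \<Sum>i<n. c i * ((X ^\<^sub>m i) *\<^sub>v col A j) $ r)"
  proof -
    from q obtain c where "q = vec (dim_row X) (\<lambda>r. \<Sum>j'<length [col A j]. \<Sum>i<dim_row X.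
        c i j' * ((X ^\<^sub>m i) *\<^sub>v ([col A j] ! j')) $ r)"
      unfolding krylov_def by blast
    then show thesis using that[of "\<lambda>i. c i 0"] X by simp
  qed
  define v where "v = vec n (\<lambda>r. \<Sum>i<n. c i * (Y ^\<^sub>m i) $$ (r, j))"
  have v: "v \<in> carrier_vec n" by (simp add: v_def)
  have Yi: "Y ^\<^sub>m i \<in> carrier_mat n n" for i using Y by auto
  have Xw: "(X ^\<^sub>m i) *\<^sub>v col A j = A *\<^sub>v col (Y ^\<^sub>m i) j" for i
  proof -
    have "(X ^\<^sub>m i) *\<^sub>v col A j = col (X ^\<^sub>m i * A) j"
      using X A j by (intro col_mult2[symmetric]) auto
    also have "\<dots> = A *\<^sub>v col (Y ^\<^sub>m i) j"
      unfolding pow_mat_intertwine[OF X Y A XA] by (rule col_mult2[OF A Yi j])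
    finally show ?thesis .
  qed
  have "q = A *\<^sub>v v"
  proof (rule eq_vecI)
    fix r assume "r < dim_vec (A *\<^sub>v v)"
    then have r: "r < n" using A by simp
    have colY: "col (Y ^\<^sub>m i) j \<in> carrier_vec n" for i using Y by (intro carrier_vecI) simp
    have "q $ r = (\<Sum>i<n. c i * (\<Sum>k<n. A $$ (r, k) * (Y ^\<^sub>m i) $$ (k, j)))"
      unfolding c Xw using r j Yi Y
      by (auto simp: index_mult_mat_vec_sum[OF A colY] simp del: index_mult_mat_vec intro!: sum.cong)
    also have "\<dots> = (\<Sum>k<n. A $$ (r, k) * (\<Sum>i<n. c i * (Y ^\<^sub>m i) $$ (k, j)))"
      unfolding sum_distrib_left by (subst sum.swap) (simp add: ac_simps)
    also have "\<dots> = (A *\<^sub>v v) $ r"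
      unfolding index_mult_mat_vec_sum[OF A v r] by (simp add: v_def)
    finally show "q $ r = (A *\<^sub>v v) $ r" .
  qed (use A c in simp)
  then show thesis using that v by blast
qed

text \<open>Applied with \<open>c = s\<^sup>2\<close>, this makes every scalar product of vectors in
  the image of \<open>A\<close> a multiple of \<open>s\<^sup>2\<close>.\<close>

lemma gram_scalar_prod:
  fixes A :: "'a::comm_ring_1 mat"
  assumes A: "A \<in> carrier_mat n n" and Z: "Z \<in> carrier_mat n n"
    and AA: "transpose_mat A * A = c \<cdot>\<^sub>m Z"
    and u: "u \<in> carrier_vec n" and v: "v \<in> carrier_vec n"
  shows "(A *\<^sub>v u) \<bullet> (A *\<^sub>v v) = c * (u \<bullet> (Z *\<^sub>v v))"
proof -
  have AT: "transpose_mat A \<in> carrier_mat n n" using A by simp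
  have "(A *\<^sub>v u) \<bullet> (A *\<^sub>v v) = u \<bullet> (transpose_mat A *\<^sub>v (A *\<^sub>v v))"
    using scalar_prod_mult_mat_vec_transpose[OF AT u mult_mat_vec_carrier[OF A v]] by simp
  also have "transpose_mat A *\<^sub>v (A *\<^sub>v v) = (c \<cdot>\<^sub>m Z) *\<^sub>v v"
    unfolding AA[symmetric] by (rule assoc_mult_mat_vec[OF AT A v, symmetric])
  also have "\<dots> = c \<cdot>\<^sub>v (Z *\<^sub>v v)"
  proof (rule eq_vecI)
    fix i assume "i < dim_vec (c \<cdot>\<^sub>v (Z *\<^sub>v v))"
    then have i: "i < n" using Z by simp
    then show "((c \<cdot>\<^sub>m Z) *\<^sub>v v) $ i = (c \<cdot>\<^sub>v (Z *\<^sub>v v)) $ i"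
      using index_mult_mat_vec_sum[OF _ v i, of "c \<cdot>\<^sub>m Z"] index_mult_mat_vec_sum[OF Z v i] Z i
      by (simp add: sum_distrib_left mult.assoc del: index_mult_mat_vec)
  qed (use Z in simp)
  also have "u \<bullet> (c \<cdot>\<^sub>v (Z *\<^sub>v v)) = c * (u \<bullet> (Z *\<^sub>v v))"
    using u mult_mat_vec_carrier[OF Z v] by simp
  finally show ?thesis .
qed

text \<open>\<open>A\<close> is \<open>s Q\<close> and \<open>Z\<close> is the Gram matrix of
  \<open>Q\<close>, both read over the ring. The relations hold over the fraction field and descend
  because \<open>to_fract\<close> is injective.\<close>

lemma integral_multiple:
  fixes X Y :: "'a::idom mat" and Q :: "'a fract mat"
  assumes X: "X \<in> carrier_mat n n" and Y: "Y \<in> carrier_mat n n" and Q: "Q \<in> carrier_mat n n"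
    and XQ: "map_mat to_fract X * Q = Q * map_mat to_fract Y"
    and QQ: "transpose_mat Q * Q \<in> integral_mats n" and s: "s \<in> level Q"
  obtains A Z where "A \<in> carrier_mat n n" "Z \<in> carrier_mat n n"
    "map_mat to_fract A = to_fract s \<cdot>\<^sub>m Q" "X * A = A * Y" "transpose_mat A * A = s\<^sup>2 \<cdot>\<^sub>m Z"
proof -
  obtain A where A: "A \<in> carrier_mat n n" and A_eq: "map_mat to_fract A = to_fract s \<cdot>\<^sub>m Q"
    using s Q unfolding level_def integral_mats_def by auto
  obtain Z where Z: "Z \<in> carrier_mat n n" and Z_eq: "map_mat to_fract Z = transpose_mat Q * Q"
    using QQ unfolding integral_mats_def by auto
  have X': "map_mat to_fract X \<in> carrier_mat n n" and Y': "map_mat to_fract Y \<in> carrier_mat n n"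
    using X Y by auto
  have AT: "transpose_mat A \<in> carrier_mat n n" and QT: "transpose_mat Q \<in> carrier_mat n n"
    using A Q by auto
  have "map_mat to_fract (X * A) = map_mat to_fract (A * Y)"
    unfolding to_fract_hom.mat_hom_mult[OF X A] to_fract_hom.mat_hom_mult[OF A Y] A_eq
      mult_smult_distrib[OF X' Q] mult_smult_assoc_mat[OF Q Y'] XQ ..
  then have XA: "X * A = A * Y" by (rule to_fract_hom.mat_hom_inj)
  have "map_mat to_fract (transpose_mat A) = transpose_mat (map_mat to_fract A)"
    by (intro eq_matI) auto
  also have "\<dots> = to_fract s \<cdot>\<^sub>m transpose_mat Q" unfolding A_eq by (intro eq_matI) auto
  finally have AT_eq: "map_mat to_fract (transpose_mat A) = to_fract s \<cdot>\<^sub>m transpose_mat Q" .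
  have sQ: "to_fract s \<cdot>\<^sub>m Q \<in> carrier_mat n n" using Q by simp
  have "map_mat to_fract (transpose_mat A * A)
      = to_fract s \<cdot>\<^sub>m (to_fract s \<cdot>\<^sub>m (transpose_mat Q * Q))"
    unfolding to_fract_hom.mat_hom_mult[OF AT A] AT_eq A_eq
      mult_smult_assoc_mat[OF QT sQ] mult_smult_distrib[OF QT Q] ..
  also have "\<dots> = map_mat to_fract (s\<^sup>2 \<cdot>\<^sub>m Z)"
    unfolding Z_eq[symmetric] by (intro eq_matI) (auto simp: power2_eq_square mult.assoc)
  finally have "transpose_mat A * A = s\<^sup>2 \<cdot>\<^sub>m Z" by (rule to_fract_hom.mat_hom_inj)
  with A Z A_eq XA show thesis by (rule that)
qed

section \<open>Reduction modulo \<open>P\<close> and scaling by fractions\<close>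

lemma poly_mat_mult_vec_index:
  assumes X: "X \<in> carrier_mat n n" and q: "q \<in> carrier_vec n" and r: "r < n"
  shows "(poly_mat G X *\<^sub>v q) $ r = (\<Sum>k\<le>degree G. poly.coeff G k * ((X ^\<^sub>m k) *\<^sub>v q) $ r)"
proof -
  have P: "X ^\<^sub>m k \<in> carrier_mat n n" for k using X by auto
  have "(poly_mat G X *\<^sub>v q) $ r
      = (\<Sum>j<n. (\<Sum>k\<le>degree G. poly.coeff G k * (X ^\<^sub>m k) $$ (r, j)) * q $ j)"
    using index_mult_mat_vec_sum[of "poly_mat G X" n n q r] X q r by (simp add: poly_mat_def)
  also have "\<dots> = (\<Sum>k\<le>degree G. \<Sum>j<n. poly.coeff G k * ((X ^\<^sub>m k) $$ (r, j) * q $ j))"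
    unfolding sum_distrib_right by (subst sum.swap) (simp add: mult.assoc)
  finally show ?thesis unfolding index_mult_mat_vec_sum[OF P q r] by (simp add: sum_distrib_left)
qed

text \<open>Powers, scalar products and the characteristic polynomial commute with \<pi>, so the
  result over the residue field applies to the reductions. The sum keeps the degree of
  \<open>G\<close> as its bound, since reduction may lower the degree.\<close>

lemma approx_sqrt_annihilates_isotropic_mod:
  fixes X :: "'a::comm_ring_1 mat" and \<pi> :: "'a \<Rightarrow> 'k::field"
  assumes X: "X \<in> carrier_mat n n" and sym: "transpose_mat X = X" and q: "q \<in> carrier_vec n"
    and \<pi>: "residue_map P \<pi>" and \<Gamma>: "is_approx_sqrt (map_poly \<pi> (char_poly X)) (map_poly \<pi> G)"
    and iso: "\<And>i. ((X ^\<^sub>m i) *\<^sub>v q) \<bullet> q \<in> P" and r: "r < n"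
  shows "(poly_mat G X *\<^sub>v q) $ r \<in> P"
proof -
  interpret \<pi>: comm_ring_hom \<pi> using \<pi> by (simp add: residue_map_def)
  have P: "x \<in> P \<longleftrightarrow> \<pi> x = 0" for x using \<pi> by (auto simp: residue_map_def)
  let ?X = "map_mat \<pi> X" and ?q = "map_vec \<pi> q"
  have X': "?X \<in> carrier_mat n n" and q': "?q \<in> carrier_vec n" using X q by auto
  have Xi: "X ^\<^sub>m i \<in> carrier_mat n n" for i using X by auto
  have hom: "(?X ^\<^sub>m i) *\<^sub>v ?q = map_vec \<pi> ((X ^\<^sub>m i) *\<^sub>v q)" for i
    unfolding \<pi>.mult_mat_vec_hom[OF Xi q] \<pi>.mat_hom_pow[OF X] ..
  have "transpose_mat ?X = map_mat \<pi> (transpose_mat X)" by (intro eq_matI) auto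
  then have sym': "transpose_mat ?X = ?X" unfolding sym .
  have iso': "((?X ^\<^sub>m i) *\<^sub>v ?q) \<bullet> ?q = 0" for i
  proof -
    have "((?X ^\<^sub>m i) *\<^sub>v ?q) \<bullet> ?q = \<pi> (((X ^\<^sub>m i) *\<^sub>v q) \<bullet> q)"
      unfolding hom using X q by (simp add: scalar_prod_def \<pi>.hom_sum \<pi>.hom_mult del: index_mult_mat_vec)
    then show ?thesis using iso P by simp
  qed
  have \<Gamma>': "is_approx_sqrt (char_poly ?X) (map_poly \<pi> G)"
    using \<Gamma> unfolding \<pi>.char_poly_hom[OF X] .
  have "\<pi> ((poly_mat G X *\<^sub>v q) $ r)
      = (\<Sum>k\<le>degree G. poly.coeff (map_poly \<pi> G) k * ((?X ^\<^sub>m k) *\<^sub>v ?q) $ r)"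
    unfolding poly_mat_mult_vec_index[OF X q r] hom using r X
    by (simp add: \<pi>.hom_sum \<pi>.hom_mult coeff_map_poly del: index_mult_mat_vec)
  also have "\<dots> = 0"
    by (rule approx_sqrt_annihilates_isotropic[OF X' sym' q' iso' \<Gamma>' degree_map_poly_le r])
  finally show ?thesis using P by simp
qed

text \<open>Here \<open>q' = c q\<close> holds only over the fraction field; linearity of
  \<open>M\<close> carries the fraction \<open>c\<close> through.\<close>

lemma mult_mat_vec_to_fract_scale:
  assumes M: "M \<in> carrier_mat n n" and q: "q \<in> carrier_vec n" and q': "q' \<in> carrier_vec n"
    and scale: "\<And>r. r < n \<Longrightarrow> to_fract (q' $ r) = c * to_fract (q $ r)" and r: "r < n"
  shows "to_fract ((M *\<^sub>v q') $ r) = c * to_fract ((M *\<^sub>v q) $ r)"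
  unfolding index_mult_mat_vec_sum[OF M q r] index_mult_mat_vec_sum[OF M q' r]
  by (simp add: sum_distrib_left scale ac_simps)

theorem theorem2p8:
  fixes X Y :: "'a::idom mat"
    and Q :: "'a fract mat"
    and P :: "'a set"
    and \<pi> :: "'a \<Rightarrow> 'k::field"
    and \<Gamma> :: "'k poly"
    and n e :: nat
  assumes "dedekind_domain TYPE('a)"
    and "X \<in> carrier_mat n n" and "transpose_mat X = X"
    and "Y \<in> carrier_mat n n"
    and "Q \<in> carrier_mat n n" and "Q \<noteq> 0\<^sub>m n n"
    and "map_mat to_fract X * Q = Q * map_mat to_fract Y"
    and "transpose_mat Q * Q \<in> integral_mats n"
    and "primeideal P class_ring" and "P \<noteq> {0}"
    and "e \<ge> 1" and "ideal_dvd (ideal_power P e) (level Q)"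
    and "residue_map P \<pi>"
    and "is_approx_sqrt (map_poly \<pi> (char_poly X)) \<Gamma>"
  shows "\<exists>w \<in> carrier_vec n.
           \<not> vec_cong0 w P \<and>
           contractive \<pi> P e X \<Gamma> (krylov X [w]) \<and>
           isotropic (ideal_power P (2 * e)) (krylov X [w])"
proof -
  note X = \<open>X \<in> carrier_mat n n\<close> and Y = \<open>Y \<in> carrier_mat n n\<close> and Q = \<open>Q \<in> carrier_mat n n\<close>
  have noeth: "noetherian_ring (class_ring :: 'a ring)" and closed: "integrally_closed TYPE('a)"
    using assms(1) unfolding dedekind_domain_def noetherian_domain_def by blast+
  have P: "ideal P class_ring" by (rule primeideal_class_ring_D(1)[OF assms(9)])
  obtain t :: "'a fract" where t: "t \<notin> range to_fract"
    and mem: "\<And>k x. x \<in> ideal_power P k \<longleftrightarrow> t ^ k * to_fract x \<in> range to_fract"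
    using dedekind_inverse_uniformizer[OF assms(1,9,10)] by blast
  have mem1: "x \<in> P \<longleftrightarrow> t * to_fract x \<in> range to_fract" for x
    using mem[of x 1] unfolding ideal_power_1[OF P] by simp
  have level: "level Q \<subseteq> ideal_power P e"
    using ideal_dvd_imp_subset[OF assms(12) ideal_ideal_power[OF P]] .
  then have "level Q \<subseteq> P"
    using ideal_power_antimono[OF P assms(11)] unfolding ideal_power_1[OF P] by (rule subset_trans)
  then obtain s i0 j0 x where s: "s \<in> level Q" and ij: "i0 < n" "j0 < n"
    and x: "to_fract s * Q $$ (i0, j0) = to_fract x" "x \<notin> P"
    using level_primitive_element[OF noeth closed t mem1[THEN iffD1] Q] by blast
  obtain A Z where A: "A \<in> carrier_mat n n" and Z: "Z \<in> carrier_mat n n"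
    and A_eq: "map_mat to_fract A = to_fract s \<cdot>\<^sub>m Q"
    and XA: "X * A = A * Y" and AA: "transpose_mat A * A = s\<^sup>2 \<cdot>\<^sub>m Z"
    by (rule integral_multiple[OF X Y Q assms(7,8) s])
  \<comment> \<open>A factor \<open>s\<close> absorbs up to \<open>e\<close> factors
    \<open>t\<close>, because \<open>s\<close> lies in the \<open>e\<close>-th power of
    \<open>P\<close>.\<close>
  have s_mem: "t ^ k * to_fract s \<in> range to_fract" if "k \<le> e" for k
    using subsetD[OF ideal_power_antimono[OF P that] subsetD[OF level s]] unfolding mem .
  define w where "w = col A j0"
  have "w $ i0 = x"
    using arg_cong[OF A_eq, of "\<lambda>M. M $$ (i0, j0)"] ij A Q x(1) by (simp add: w_def)
  moreover have w: "w \<in> carrier_vec n" using A by (intro carrier_vecI) (simp add: w_def)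
  ultimately have "\<not> vec_cong0 w P"
    using ij x(2) by (auto simp: vec_cong0_iff)
  moreover have "isotropic (ideal_power P (2 * e)) (krylov X [w])"
    unfolding isotropic_def
  proof (intro ballI)
    fix q1 q2 assume "q1 \<in> krylov X [w]" "q2 \<in> krylov X [w]"
    then obtain v1 v2 where v: "v1 \<in> carrier_vec n" "v2 \<in> carrier_vec n"
      and q: "q1 = A *\<^sub>v v1" "q2 = A *\<^sub>v v2"
      unfolding w_def using krylov_intertwine[OF X Y A XA ij(2)] by metis
    \<comment> \<open>The scalar product has a factor \<open>s\<^sup>2\<close>, and each of the two
      factors \<open>s\<close> absorbs \<open>e\<close> of the \<open>2 * e\<close> factors
      \<open>t\<close>.\<close>
    have "t ^ (2 * e) * to_fract (q1 \<bullet> q2)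
        = (t ^ e * to_fract s) * ((t ^ e * to_fract s) * to_fract (v1 \<bullet> (Z *\<^sub>v v2)))"
      unfolding q gram_scalar_prod[OF A Z AA v]
      by (simp add: power2_eq_square mult_2 power_add mult.assoc mult.left_commute)
    then show "q1 \<bullet> q2 \<in> ideal_power P (2 * e)"
      unfolding mem by (simp only:) (intro range_to_fract_closed(2) s_mem order_refl rangeI)
  qed
  moreover have "contractive \<pi> P e X \<Gamma> (krylov X [w])"
    unfolding contractive_def
  proof (intro allI ballI impI)
    fix G k q
    assume G: "map_poly \<pi> G = \<Gamma>" and k: "k < e" and "q \<in> krylov X [w]"
      and cong: "vec_cong0 q (ideal_power P k)"
    then obtain v where v: "v \<in> carrier_vec n" and q: "q = A *\<^sub>v v"
      unfolding w_def using krylov_intertwine[OF X Y A XA ij(2)] by metis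
    have qn: "q \<in> carrier_vec n" unfolding q by (rule mult_mat_vec_carrier[OF A v])
    have "\<exists>y. to_fract y = t ^ k * to_fract (q $ r)" if "r < n" for r
    proof -
      have "q $ r \<in> ideal_power P k"
        using cong qn that by (simp add: vec_cong0_iff)
      then show ?thesis unfolding mem by auto
    qed
    then obtain f where f: "\<And>r. r < n \<Longrightarrow> to_fract (f r) = t ^ k * to_fract (q $ r)" by metis
    \<comment> \<open>\<open>q' = t^k q\<close> is \<open>q\<close> divided by the
      \<open>k\<close>-th power of a uniformizer; it has entries in the ring because
      \<open>q\<close> vanishes modulo the \<open>k\<close>-th power of \<open>P\<close>.\<close>
    define q' where "q' = vec n f"
    have q': "q' \<in> carrier_vec n" and q'_eq: "\<And>r. r < n \<Longrightarrow> to_fract (q' $ r) = t ^ k * to_fract (q $ r)"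
      by (simp_all add: q'_def f)
    have Xi: "X ^\<^sub>m i \<in> carrier_mat n n" and Yi: "Y ^\<^sub>m i \<in> carrier_mat n n" for i using X Y by auto
    have iso: "((X ^\<^sub>m i) *\<^sub>v q') \<bullet> q' \<in> P" for i
    proof -
      have Yv: "(Y ^\<^sub>m i) *\<^sub>v v \<in> carrier_vec n" by (rule mult_mat_vec_carrier[OF Yi v])
      have Xq: "(X ^\<^sub>m i) *\<^sub>v q = A *\<^sub>v ((Y ^\<^sub>m i) *\<^sub>v v)"
        unfolding q assoc_mult_mat_vec[OF Xi A v, symmetric] pow_mat_intertwine[OF X Y A XA]
        by (rule assoc_mult_mat_vec[OF A Yi v])
      have "to_fract (((X ^\<^sub>m i) *\<^sub>v q') \<bullet> q')
          = (\<Sum>r<n. to_fract (((X ^\<^sub>m i) *\<^sub>v q') $ r) * to_fract (q' $ r))"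
        using q' by (simp add: scalar_prod_def lessThan_atLeast0 del: index_mult_mat_vec)
      also have "\<dots> = (\<Sum>r<n. (t ^ k * to_fract (((X ^\<^sub>m i) *\<^sub>v q) $ r)) * (t ^ k * to_fract (q $ r)))"
        by (intro sum.cong refl) (simp only: lessThan_iff q'_eq mult_mat_vec_to_fract_scale[OF Xi qn q' q'_eq])
      also have "\<dots> = t ^ k * t ^ k * to_fract (((X ^\<^sub>m i) *\<^sub>v q) \<bullet> q)"
        using qn by (simp add: scalar_prod_def lessThan_atLeast0 sum_distrib_left ac_simps del: index_mult_mat_vec)
      also have "((X ^\<^sub>m i) *\<^sub>v q) \<bullet> q = s\<^sup>2 * (((Y ^\<^sub>m i) *\<^sub>v v) \<bullet> (Z *\<^sub>v v))"
        unfolding Xq unfolding q by (rule gram_scalar_prod[OF A Z AA Yv v])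
      \<comment> \<open>Two vectors \<open>q'\<close> contribute \<open>2 k\<close> factors
        \<open>t\<close> and membership in \<open>P\<close> asks for one more. Split as
        \<open>k + 1\<close> and \<open>k\<close>, they are absorbed by the two factors
        \<open>s\<close>, since \<open>k < e\<close>.\<close>
      finally have "t * to_fract (((X ^\<^sub>m i) *\<^sub>v q') \<bullet> q')
          = (t ^ Suc k * to_fract s) * ((t ^ k * to_fract s) * to_fract (((Y ^\<^sub>m i) *\<^sub>v v) \<bullet> (Z *\<^sub>v v)))"
        by (simp add: power2_eq_square mult.assoc mult.left_commute)
      then show ?thesis
        unfolding mem1 by (simp only:) (intro range_to_fract_closed(2) s_mem rangeI; use k in simp)
    qed
    have "(poly_mat G X *\<^sub>v q) $ r \<in> ideal_power P (k + 1)" if r: "r < n" for r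
    proof -
      have "poly_mat G X \<in> carrier_mat n n" using X by (simp add: poly_mat_def)
      \<comment> \<open>Of the \<open>k + 1\<close> factors \<open>t\<close>, \<open>k\<close> turn
        \<open>q\<close> into \<open>q'\<close>, and the last one tests membership in
        \<open>P\<close>.\<close>
      then have "t ^ (k + 1) * to_fract ((poly_mat G X *\<^sub>v q) $ r) = t * to_fract ((poly_mat G X *\<^sub>v q') $ r)"
        using mult_mat_vec_to_fract_scale[OF _ qn q' q'_eq r] by (simp add: ac_simps del: index_mult_mat_vec)
      moreover have "(poly_mat G X *\<^sub>v q') $ r \<in> P"
        using approx_sqrt_annihilates_isotropic_mod[OF X assms(3) q' assms(13) _ iso r] assms(14) G by blast
      ultimately show ?thesis unfolding mem mem1 by (simp only:)
    qed
    then show "vec_cong0 (poly_mat G X *\<^sub>v q) (ideal_power P (k + 1))"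
      using X by (auto simp: vec_cong0_iff poly_mat_def simp del: index_mult_mat_vec)
  qed
  ultimately show ?thesis using w by blast
qed

end
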